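(* Let $\mathfrak g$ be an untwisted affine Kac–Moody algebra (not of type $A_1^{(1)}$) with underlying finite-dimensional simple Lie algebra $\mathfrak g_0$, and let $\mathfrak g'=[\mathfrak g,\mathfrak g]$. There are isomorphisms of Lie algebras $$\mathfrak{uce}(\mathfrak g_0[t_1^{\pm1},t_2])\cong\mathfrak{uce}(\mathfrak g'[t])\qquad\text{and}\qquad\mathfrak{uce}(\mathfrak g_0[t_1^{\pm1},t_2^{\pm1}])\cong\mathfrak{uce}(\mathfrak g'[t^{\pm1}]).$$
   Context: All Lie algebras are over $\mathbb C$. $\mathfrak g_0[t_1^{\pm1},t_2]=\mathfrak g_0\otimes\mathbb C[t_1^{\pm1},t_2]$, $\mathfrak g_0[t_1^{\pm1},t_2^{\pm1}]=\mathfrak g_0\otimes\mathbb C[t_1^{\pm1},t_2^{\pm1}]$, $\mathfrak g'[t]=\mathfrak g'\otimes\mathbb C[t]$, $\mathfrak g'[t^{\pm1}]=\mathfrak g'\otimes\mathbb C[t^{\pm1}]$, each with the natural (pointwise) bracket. $\mathfrak{uce}(\mathfrak p)$ denotes the universal central extension of a perfect Lie algebra $\mathfrak p$. *)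

theory Defs
  imports
    "Jordan_Normal_Form.VS_Connect"
    "HOL-Algebra.QuotRing"
    "HOL-Library.Product_Plus"
begin

section \<open>Lie algebras over the complex numbers\<close>

text \<open>
  A complex Lie algebra is a \<^const>\<open>vectorspace\<close> over \<open>\<complex>\<close> whose multiplication field
  (not used by the vector space structure) is the Lie bracket; the field \<^const>\<open>one\<close> carries no
  meaning.
\<close>

type_synonym 'a lie_alg = "(complex, 'a) module"

abbreviation (input) lie_bracket :: "'a lie_alg \<Rightarrow> 'a \<Rightarrow> 'a \<Rightarrow> 'a"
  ("\<lbrakk>_, _\<rbrakk>\<index>") where
  "\<lbrakk>x, y\<rbrakk>\<^bsub>L\<^esub> \<equiv> x \<otimes>\<^bsub>L\<^esub> y"

locale lie_algebra = vectorspace "class_ring :: complex ring" L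
  for L :: "'a lie_alg" (structure) +
  assumes bracket_closed [simp, intro]:
      "x \<in> carrier L \<Longrightarrow> y \<in> carrier L \<Longrightarrow> \<lbrakk>x, y\<rbrakk>\<^bsub>L\<^esub> \<in> carrier L"
    and bracket_add_left:
      "x \<in> carrier L \<Longrightarrow> y \<in> carrier L \<Longrightarrow> z \<in> carrier L \<Longrightarrow>
        \<lbrakk>x \<oplus>\<^bsub>L\<^esub> y, z\<rbrakk>\<^bsub>L\<^esub> = \<lbrakk>x, z\<rbrakk>\<^bsub>L\<^esub> \<oplus>\<^bsub>L\<^esub> \<lbrakk>y, z\<rbrakk>\<^bsub>L\<^esub>"
    and bracket_add_right:
      "x \<in> carrier L \<Longrightarrow> y \<in> carrier L \<Longrightarrow> z \<in> carrier L \<Longrightarrow>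
        \<lbrakk>x, y \<oplus>\<^bsub>L\<^esub> z\<rbrakk>\<^bsub>L\<^esub> = \<lbrakk>x, y\<rbrakk>\<^bsub>L\<^esub> \<oplus>\<^bsub>L\<^esub> \<lbrakk>x, z\<rbrakk>\<^bsub>L\<^esub>"
    and bracket_smult_left:
      "x \<in> carrier L \<Longrightarrow> y \<in> carrier L \<Longrightarrow>
        \<lbrakk>a \<odot>\<^bsub>L\<^esub> x, y\<rbrakk>\<^bsub>L\<^esub> = a \<odot>\<^bsub>L\<^esub> \<lbrakk>x, y\<rbrakk>\<^bsub>L\<^esub>"
    and bracket_smult_right:
      "x \<in> carrier L \<Longrightarrow> y \<in> carrier L \<Longrightarrow>
        \<lbrakk>x, a \<odot>\<^bsub>L\<^esub> y\<rbrakk>\<^bsub>L\<^esub> = a \<odot>\<^bsub>L\<^esub> \<lbrakk>x, y\<rbrakk>\<^bsub>L\<^esub>"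
    and bracket_self: "x \<in> carrier L \<Longrightarrow> \<lbrakk>x, x\<rbrakk>\<^bsub>L\<^esub> = \<zero>\<^bsub>L\<^esub>"
    and jacobi:
      "x \<in> carrier L \<Longrightarrow> y \<in> carrier L \<Longrightarrow> z \<in> carrier L \<Longrightarrow>
        \<lbrakk>x, \<lbrakk>y, z\<rbrakk>\<^bsub>L\<^esub>\<rbrakk>\<^bsub>L\<^esub> \<oplus>\<^bsub>L\<^esub> \<lbrakk>y, \<lbrakk>z, x\<rbrakk>\<^bsub>L\<^esub>\<rbrakk>\<^bsub>L\<^esub> \<oplus>\<^bsub>L\<^esub> \<lbrakk>z, \<lbrakk>x, y\<rbrakk>\<^bsub>L\<^esub>\<rbrakk>\<^bsub>L\<^esub> = \<zero>\<^bsub>L\<^esub>"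

definition lie_hom :: "'a lie_alg \<Rightarrow> 'b lie_alg \<Rightarrow> ('a \<Rightarrow> 'b) set" where
  "lie_hom L M = {\<phi> \<in> LinearCombinations.module_hom class_ring L M.
     \<forall>x\<in>carrier L. \<forall>y\<in>carrier L. \<phi> \<lbrakk>x, y\<rbrakk>\<^bsub>L\<^esub> = \<lbrakk>\<phi> x, \<phi> y\<rbrakk>\<^bsub>M\<^esub>}"

definition lie_isomorphic :: "'a lie_alg \<Rightarrow> 'b lie_alg \<Rightarrow> bool" (infix "\<cong>\<^sub>L" 50) where
  "L \<cong>\<^sub>L M \<longleftrightarrow> (\<exists>\<phi>\<in>lie_hom L M. bij_betw \<phi> (carrier L) (carrier M))"

definition lie_ideal :: "'a set \<Rightarrow> 'a lie_alg \<Rightarrow> bool" where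
  "lie_ideal I L \<longleftrightarrow>
     subspace class_ring I L \<and> (\<forall>x\<in>carrier L. \<forall>y\<in>I. \<lbrakk>x, y\<rbrakk>\<^bsub>L\<^esub> \<in> I)"

definition simple_lie_algebra :: "'a lie_alg \<Rightarrow> bool" where
  "simple_lie_algebra L \<longleftrightarrow> lie_algebra L
     \<and> (\<exists>x\<in>carrier L. \<exists>y\<in>carrier L. \<lbrakk>x, y\<rbrakk>\<^bsub>L\<^esub> \<noteq> \<zero>\<^bsub>L\<^esub>)
     \<and> (\<forall>I. lie_ideal I L \<longrightarrow> I = {\<zero>\<^bsub>L\<^esub>} \<or> I = carrier L)"

definition derived_algebra :: "'a lie_alg \<Rightarrow> 'a lie_alg" where
  "derived_algebra L = L\<lparr>carrier := LinearCombinations.module.span class_ring L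
     {\<lbrakk>x, y\<rbrakk>\<^bsub>L\<^esub> | x y. x \<in> carrier L \<and> y \<in> carrier L}\<rparr>"

definition perfect_lie_algebra :: "'a lie_alg \<Rightarrow> bool" where
  "perfect_lie_algebra L \<longleftrightarrow> lie_algebra L \<and> carrier (derived_algebra L) = carrier L"

definition sl2 :: "complex mat lie_alg" where
  "sl2 = (module_mat TYPE(complex) 2 2)
     \<lparr>carrier := {A \<in> carrier_mat 2 2. (\<Sum>i<2. A $$ (i, i)) = 0},
      mult := (\<lambda>A B. A * B - B * A)\<rparr>"


section \<open>Extension of scalars to (Laurent) polynomial rings\<close>

text \<open>
  \<open>L \<otimes> \<complex>[M]\<close> for the monoid algebra \<open>\<complex>[M]\<close> of an additive commutative monoid \<open>M\<close>
  (the type \<open>'m\<close>): the finitely supported function \<open>f\<close> stands for \<open>\<Sum>m. f m \<otimes> t^m\<close>, and the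
  bracket is the bilinear extension of \<open>[x \<otimes> t^i, y \<otimes> t^j] = [x, y] \<otimes> t^(i + j)\<close>.
\<close>

definition monoid_extension ::
    "'m::comm_monoid_add itself \<Rightarrow> 'a lie_alg \<Rightarrow> ('m \<Rightarrow> 'a) lie_alg" where
  "monoid_extension _ L =
    \<lparr>carrier = {f. range f \<subseteq> carrier L \<and> finite {m. f m \<noteq> \<zero>\<^bsub>L\<^esub>}},
     mult = (\<lambda>f g m. \<Oplus>\<^bsub>L\<^esub>p\<in>{(i, j). f i \<noteq> \<zero>\<^bsub>L\<^esub> \<and> g j \<noteq> \<zero>\<^bsub>L\<^esub> \<and> i + j = m}.
              \<lbrakk>f (fst p), g (snd p)\<rbrakk>\<^bsub>L\<^esub>),
     one = undefined,
     zero = (\<lambda>m. \<zero>\<^bsub>L\<^esub>),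
     add = (\<lambda>f g m. f m \<oplus>\<^bsub>L\<^esub> g m),
     smult = (\<lambda>a f m. a \<odot>\<^bsub>L\<^esub> f m)\<rparr>"

text \<open>\<open>L[t]\<close>, \<open>L[t\<^sup>\<plusminus>\<^sup>1]\<close>, \<open>L[t\<^sub>1\<^sup>\<plusminus>\<^sup>1, t\<^sub>2]\<close> and \<open>L[t\<^sub>1\<^sup>\<plusminus>\<^sup>1, t\<^sub>2\<^sup>\<plusminus>\<^sup>1]\<close>.\<close>

abbreviation polynomial_lie :: "'a lie_alg \<Rightarrow> (nat \<Rightarrow> 'a) lie_alg" where
  "polynomial_lie \<equiv> monoid_extension TYPE(nat)"

abbreviation laurent_lie :: "'a lie_alg \<Rightarrow> (int \<Rightarrow> 'a) lie_alg" where
  "laurent_lie \<equiv> monoid_extension TYPE(int)"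

abbreviation laurent_polynomial_lie :: "'a lie_alg \<Rightarrow> (int \<times> nat \<Rightarrow> 'a) lie_alg" where
  "laurent_polynomial_lie \<equiv> monoid_extension TYPE(int \<times> nat)"

abbreviation laurent2_lie :: "'a lie_alg \<Rightarrow> (int \<times> int \<Rightarrow> 'a) lie_alg" where
  "laurent2_lie \<equiv> monoid_extension TYPE(int \<times> int)"


section \<open>Untwisted affine Kac--Moody algebras\<close>

definition invariant_form :: "'a lie_alg \<Rightarrow> ('a \<Rightarrow> 'a \<Rightarrow> complex) \<Rightarrow> bool" where
  "invariant_form L \<kappa> \<longleftrightarrow>
     (\<forall>x\<in>carrier L. \<forall>y\<in>carrier L. \<forall>z\<in>carrier L. \<kappa> (x \<oplus>\<^bsub>L\<^esub> y) z = \<kappa> x z + \<kappa> y z)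
     \<and> (\<forall>a. \<forall>x\<in>carrier L. \<forall>y\<in>carrier L. \<kappa> (a \<odot>\<^bsub>L\<^esub> x) y = a * \<kappa> x y)
     \<and> (\<forall>x\<in>carrier L. \<forall>y\<in>carrier L. \<kappa> x y = \<kappa> y x)
     \<and> (\<forall>x\<in>carrier L. \<forall>y\<in>carrier L. \<forall>z\<in>carrier L. \<kappa> \<lbrakk>x, y\<rbrakk>\<^bsub>L\<^esub> z = \<kappa> x \<lbrakk>y, z\<rbrakk>\<^bsub>L\<^esub>)"

definition nondegenerate_form :: "'a lie_alg \<Rightarrow> ('a \<Rightarrow> 'a \<Rightarrow> complex) \<Rightarrow> bool" where
  "nondegenerate_form L \<kappa> \<longleftrightarrow>
     (\<forall>x\<in>carrier L. (\<forall>y\<in>carrier L. \<kappa> x y = 0) \<longrightarrow> x = \<zero>\<^bsub>L\<^esub>)"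

text \<open>
  \<open>L[t\<^sup>\<plusminus>\<^sup>1] \<oplus> \<complex>c \<oplus> \<complex>d\<close>, the triple \<open>(f, a, b)\<close> standing for \<open>f + a c + b d\<close>, with \<open>c\<close> central and
    \<open>[x t^m, y t^n] = [x, y] t^(m + n) + m \<delta>(m + n, 0) \<kappa>(x, y) c\<close>,  \<open>[d, x t^n] = n x t^n\<close>.
\<close>

definition affine_lie :: "'a lie_alg \<Rightarrow> ('a \<Rightarrow> 'a \<Rightarrow> complex) \<Rightarrow> ((int \<Rightarrow> 'a) \<times> complex \<times> complex) lie_alg"
where
  "affine_lie L \<kappa> =
    \<lparr>carrier = carrier (laurent_lie L) \<times> UNIV \<times> UNIV,
     mult = (\<lambda>(f, _, b) (g, _, b').
       ((\<lambda>n. \<lbrakk>f, g\<rbrakk>\<^bsub>laurent_lie L\<^esub> n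
              \<oplus>\<^bsub>L\<^esub> (b * of_int n) \<odot>\<^bsub>L\<^esub> g n \<ominus>\<^bsub>L\<^esub> (b' * of_int n) \<odot>\<^bsub>L\<^esub> f n),
        (\<Sum>n\<in>{n. f n \<noteq> \<zero>\<^bsub>L\<^esub>}. of_int n * \<kappa> (f n) (g (- n))),
        0)),
     one = undefined,
     zero = (\<lambda>n. \<zero>\<^bsub>L\<^esub>, 0, 0),
     add = (\<lambda>(f, a, b) (g, a', b'). (\<lambda>n. f n \<oplus>\<^bsub>L\<^esub> g n, a + a', b + b')),
     smult = (\<lambda>s (f, a, b). (\<lambda>n. s \<odot>\<^bsub>L\<^esub> f n, s * a, s * b))\<rparr>"

text \<open>
  Over a finite-dimensional simple \<open>L\<close> any two nondegenerate invariant symmetric forms are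
  proportional, so by rescaling \<open>c\<close> the isomorphism class does not depend on \<open>\<kappa>\<close>; in particular
  \<open>\<kappa>\<close> may be the normalized invariant form or the Killing form.
\<close>

definition untwisted_affine :: "'a lie_alg \<Rightarrow> 'b lie_alg \<Rightarrow> bool" where
  "untwisted_affine L A \<longleftrightarrow> lie_algebra A
     \<and> (\<exists>\<kappa>. invariant_form L \<kappa> \<and> nondegenerate_form L \<kappa> \<and> A \<cong>\<^sub>L affine_lie L \<kappa>)"


section \<open>Universal central extensions\<close>

definition central_extension :: "'e lie_alg \<Rightarrow> ('e \<Rightarrow> 'a) \<Rightarrow> 'a lie_alg \<Rightarrow> bool" where
  "central_extension E \<pi> L \<longleftrightarrow> lie_algebra E \<and> lie_algebra L
     \<and> \<pi> \<in> lie_hom E L \<and> \<pi> ` carrier E = carrier L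
     \<and> (\<forall>z\<in>carrier E. \<pi> z = \<zero>\<^bsub>L\<^esub> \<longrightarrow> (\<forall>x\<in>carrier E. \<lbrakk>z, x\<rbrakk>\<^bsub>E\<^esub> = \<zero>\<^bsub>E\<^esub>))"

text \<open>
  The type argument is the type on which the competing central extensions live.
\<close>

definition universal_central_extension ::
    "'e itself \<Rightarrow> 'u lie_alg \<Rightarrow> ('u \<Rightarrow> 'a) \<Rightarrow> 'a lie_alg \<Rightarrow> bool" where
  "universal_central_extension _ U \<pi> L \<longleftrightarrow> central_extension U \<pi> L
     \<and> (\<forall>(E :: 'e lie_alg) \<rho>. central_extension E \<rho> L \<longrightarrow>
          (\<exists>\<phi>\<in>lie_hom U E. (\<forall>x\<in>carrier U. \<rho> (\<phi> x) = \<pi> x)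
             \<and> (\<forall>\<psi>\<in>lie_hom U E. (\<forall>x\<in>carrier U. \<rho> (\<psi> x) = \<pi> x) \<longrightarrow>
                  (\<forall>x\<in>carrier U. \<psi> x = \<phi> x))))"

text \<open>
  A universal central extension of \<open>L\<close> is the quotient of the space of formal linear combinations
  of symbols \<open>\<langle>x, y\<rangle>\<close> (\<open>x, y \<in> L\<close>) by the relations making \<open>\<langle>x, y\<rangle>\<close> bilinear and alternating and
  \<open>\<langle>x, [y, z]\<rangle> + \<langle>y, [z, x]\<rangle> + \<langle>z, [x, y]\<rangle> = 0\<close>, with bracket
  \<open>[\<langle>x, y\<rangle>, \<langle>z, w\<rangle>] = \<langle>[x, y], [z, w]\<rangle>\<close> and projection \<open>\<langle>x, y\<rangle> \<mapsto> [x, y]\<close>. The theorem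
  \<open>uce_universal\<close> below proves the universal property if \<open>L\<close> is perfect.
\<close>

definition symb :: "'a \<Rightarrow> 'a \<Rightarrow> 'a \<times> 'a \<Rightarrow> complex" where
  "symb x y = (\<lambda>p. if p = (x, y) then 1 else 0)"

definition symb_eval :: "'a lie_alg \<Rightarrow> ('a \<times> 'a \<Rightarrow> complex) \<Rightarrow> 'a" where
  "symb_eval L c = (\<Oplus>\<^bsub>L\<^esub>p\<in>{p. c p \<noteq> 0}. c p \<odot>\<^bsub>L\<^esub> \<lbrakk>fst p, snd p\<rbrakk>\<^bsub>L\<^esub>)"

text \<open>The product on formal combinations is bilinear only modulo the relations below.\<close>

definition symb_space :: "'a lie_alg \<Rightarrow> ('a \<times> 'a \<Rightarrow> complex) lie_alg" where
  "symb_space L =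
    \<lparr>carrier = {c. finite {p. c p \<noteq> 0} \<and> {p. c p \<noteq> 0} \<subseteq> carrier L \<times> carrier L},
     mult = (\<lambda>c d. symb (symb_eval L c) (symb_eval L d)),
     one = undefined,
     zero = (\<lambda>p. 0),
     add = (\<lambda>c d p. c p + d p),
     smult = (\<lambda>a c p. a * c p)\<rparr>"

definition symb_relators :: "'a lie_alg \<Rightarrow> ('a \<times> 'a \<Rightarrow> complex) set" where
  "symb_relators L =
     {\<lambda>p. symb (x \<oplus>\<^bsub>L\<^esub> y) z p - symb x z p - symb y z p | x y z.
         x \<in> carrier L \<and> y \<in> carrier L \<and> z \<in> carrier L}
    \<union> {\<lambda>p. symb (a \<odot>\<^bsub>L\<^esub> x) y p - a * symb x y p | a x y. x \<in> carrier L \<and> y \<in> carrier L}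
    \<union> {\<lambda>p. symb x (y \<oplus>\<^bsub>L\<^esub> z) p - symb x y p - symb x z p | x y z.
         x \<in> carrier L \<and> y \<in> carrier L \<and> z \<in> carrier L}
    \<union> {\<lambda>p. symb x (a \<odot>\<^bsub>L\<^esub> y) p - a * symb x y p | a x y. x \<in> carrier L \<and> y \<in> carrier L}
    \<union> {symb x x | x. x \<in> carrier L}
    \<union> {\<lambda>p. symb x \<lbrakk>y, z\<rbrakk>\<^bsub>L\<^esub> p + symb y \<lbrakk>z, x\<rbrakk>\<^bsub>L\<^esub> p + symb z \<lbrakk>x, y\<rbrakk>\<^bsub>L\<^esub> p | x y z.
         x \<in> carrier L \<and> y \<in> carrier L \<and> z \<in> carrier L}"

definition symb_relations :: "'a lie_alg \<Rightarrow> ('a \<times> 'a \<Rightarrow> complex) set" where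
  "symb_relations L =
     LinearCombinations.module.span class_ring (symb_space L) (symb_relators L)"

definition uce :: "'a lie_alg \<Rightarrow> ('a \<times> 'a \<Rightarrow> complex) set lie_alg" where
  "uce L = (let F = symb_space L; R = symb_relations L in
    \<lparr>carrier = a_rcosets\<^bsub>F\<^esub> R,
     mult = rcoset_mult F R,
     one = undefined,
     zero = R,
     add = set_add F,
     smult = (\<lambda>a X. \<Union>c\<in>X. R +>\<^bsub>F\<^esub> (a \<odot>\<^bsub>F\<^esub> c))\<rparr>)"

definition uce_proj :: "'a lie_alg \<Rightarrow> ('a \<times> 'a \<Rightarrow> complex) set \<Rightarrow> 'a" where
  "uce_proj L X = the_elem (symb_eval L ` X)"


section \<open>Universality of the construction\<close>

lemma symb_space_simps:
  "carrier (symb_space L) = {c. finite {p. c p \<noteq> 0} \<and> {p. c p \<noteq> 0} \<subseteq> carrier L \<times> carrier L}"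
  "\<zero>\<^bsub>symb_space L\<^esub> = (\<lambda>p. 0)"
  "c \<oplus>\<^bsub>symb_space L\<^esub> d = (\<lambda>p. c p + d p)"
  "a \<odot>\<^bsub>symb_space L\<^esub> c = (\<lambda>p. a * c p)"
  "c \<otimes>\<^bsub>symb_space L\<^esub> d = symb (symb_eval L c) (symb_eval L d)"
  by (simp_all add: symb_space_def)

lemma symb_space_add_closed:
  assumes "c \<in> carrier (symb_space L)" "d \<in> carrier (symb_space L)"
  shows "(\<lambda>p. a * c p + b * d p) \<in> carrier (symb_space L)"
proof -
  have "{p. a * c p + b * d p \<noteq> 0} \<subseteq> {p. c p \<noteq> 0} \<union> {p. d p \<noteq> 0}"
    by auto
  with assms show ?thesis
    unfolding symb_space_simps
    by (auto intro: finite_subset)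
qed

lemma symb_space_module: "module (class_ring :: complex ring) (symb_space L)"
proof (rule module_criteria)
  show "cring (class_ring :: complex ring)"
    by (rule class_cring.is_cring)
  show "\<zero>\<^bsub>symb_space L\<^esub> \<in> carrier (symb_space L)"
    by (simp add: symb_space_simps)
  show "\<forall>v w. v \<in> carrier (symb_space L) \<and> w \<in> carrier (symb_space L) \<longrightarrow>
      v \<oplus>\<^bsub>symb_space L\<^esub> w \<in> carrier (symb_space L)"
    using symb_space_add_closed[of _ L _ 1 1] by (auto simp: symb_space_simps(3))
  show "\<forall>v\<in>carrier (symb_space L). \<exists>w\<in>carrier (symb_space L).
      v \<oplus>\<^bsub>symb_space L\<^esub> w = \<zero>\<^bsub>symb_space L\<^esub>"
  proof
    fix v assume v: "v \<in> carrier (symb_space L)"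
    show "\<exists>w\<in>carrier (symb_space L). v \<oplus>\<^bsub>symb_space L\<^esub> w = \<zero>\<^bsub>symb_space L\<^esub>"
      using symb_space_add_closed[OF v v, of "-1" 0]
      by (intro bexI[of _ "\<lambda>p. - v p"]) (auto simp: symb_space_simps(2,3))
  qed
  show "\<forall>c v. c \<in> carrier (class_ring :: complex ring) \<and> v \<in> carrier (symb_space L) \<longrightarrow>
      c \<odot>\<^bsub>symb_space L\<^esub> v \<in> carrier (symb_space L)"
    using symb_space_add_closed[of _ L _ _ 0] by (auto simp: symb_space_simps(4))
qed (auto simp: symb_space_simps algebra_simps)

lemma symb_in_symb_space:
  "x \<in> carrier L \<Longrightarrow> y \<in> carrier L \<Longrightarrow> symb x y \<in> carrier (symb_space L)"
  by (auto simp: symb_space_simps symb_def)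

lemma symb_space_eqI:
  assumes N: "submodule (class_ring :: complex ring) N (symb_space L)"
    and symb: "\<And>x y. x \<in> carrier L \<Longrightarrow> y \<in> carrier L \<Longrightarrow> symb x y \<in> N"
    and c: "c \<in> carrier (symb_space L)"
  shows "c \<in> N"
proof -
  have "\<forall>c. {p. c p \<noteq> 0} \<subseteq> S \<longrightarrow> c \<in> N"
    if "finite S" "S \<subseteq> carrier L \<times> carrier L" for S
    using that
  proof (induction S rule: finite_induct)
    case empty
    have "(\<lambda>p. 0) \<in> N"
      using submodule.zero_closed[OF N] by (simp add: symb_space_simps)
    moreover have "c = (\<lambda>p. 0)" if "{p. c p \<noteq> 0} \<subseteq> {}" for c :: "'a \<times> 'a \<Rightarrow> complex"
      using that by auto
    ultimately show ?case by metis
  next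
    case (insert s S)
    show ?case
    proof (intro allI impI)
      fix c :: "'a \<times> 'a \<Rightarrow> complex" assume sub: "{p. c p \<noteq> 0} \<subseteq> insert s S"
      obtain x y where s: "s = (x, y)" by fastforce
      have "c(s := 0) \<in> N"
      proof -
        have "{p. (c(s := 0)) p \<noteq> 0} \<subseteq> S"
          using sub by auto
        with insert show ?thesis by blast
      qed
      moreover have "c s \<odot>\<^bsub>symb_space L\<^esub> symb x y \<in> N"
        using insert.prems symb s by (intro submodule.smult_closed[OF N]) auto
      ultimately have "c(s := 0) \<oplus>\<^bsub>symb_space L\<^esub> (c s \<odot>\<^bsub>symb_space L\<^esub> symb x y) \<in> N"
        by (rule submodule.m_closed[OF N])
      moreover have "c(s := 0) \<oplus>\<^bsub>symb_space L\<^esub> (c s \<odot>\<^bsub>symb_space L\<^esub> symb x y) = c"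
        by (auto simp: symb_space_simps symb_def s)
      ultimately show "c \<in> N" by simp
    qed
  qed
  with c show ?thesis
    by (auto simp: symb_space_simps)
qed

definition lin_ext :: "'e lie_alg \<Rightarrow> ('p \<Rightarrow> 'e) \<Rightarrow> ('p \<Rightarrow> complex) \<Rightarrow> 'e" where
  "lin_ext M g c = (\<Oplus>\<^bsub>M\<^esub>p\<in>{p. c p \<noteq> 0}. c p \<odot>\<^bsub>M\<^esub> g p)"

lemma symb_eval_lin_ext: "symb_eval L = lin_ext L (\<lambda>p. \<lbrakk>fst p, snd p\<rbrakk>\<^bsub>L\<^esub>)"
  by (simp add: symb_eval_def lin_ext_def fun_eq_iff)

lemma lin_ext_superset:
  assumes M: "module (class_ring :: complex ring) M"
    and "finite A" "{p. c p \<noteq> 0} \<subseteq> A" "g \<in> A \<rightarrow> carrier M"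
  shows "lin_ext M g c = (\<Oplus>\<^bsub>M\<^esub>p\<in>A. c p \<odot>\<^bsub>M\<^esub> g p)"
proof -
  interpret M: Module.module "class_ring :: complex ring" M by (rule M)
  show ?thesis
    unfolding lin_ext_def
    using assms(2-4) M.smult_l_null
    by (intro M.add.finprod_mono_neutral_cong_left) (auto simp: Pi_iff)
qed

lemma lin_ext_hom:
  assumes M: "module (class_ring :: complex ring) M"
    and g: "g \<in> carrier L \<times> carrier L \<rightarrow> carrier M"
  shows "lin_ext M g \<in> LinearCombinations.module_hom class_ring (symb_space L) M"
proof -
  interpret M: Module.module "class_ring :: complex ring" M by (rule M)
  have g': "A \<subseteq> carrier L \<times> carrier L \<Longrightarrow> p \<in> A \<Longrightarrow> g p \<in> carrier M" for A p
    using g by (auto simp: Pi_iff)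
  have closed: "lin_ext M g c \<in> carrier M" if "c \<in> carrier (symb_space L)" for c
    using that g'[of "{p. c p \<noteq> 0}"] unfolding lin_ext_def symb_space_simps
    by (intro M.finsum_closed Pi_I M.smult_closed) auto
  have add: "lin_ext M g (\<lambda>p. c p + d p) = lin_ext M g c \<oplus>\<^bsub>M\<^esub> lin_ext M g d"
    if c: "c \<in> carrier (symb_space L)" and d: "d \<in> carrier (symb_space L)" for c d
  proof -
    define A where "A = {p. c p \<noteq> 0} \<union> {p. d p \<noteq> 0}"
    have A: "finite A" "A \<subseteq> carrier L \<times> carrier L"
      using c d by (auto simp: A_def symb_space_simps)
    have gA: "g \<in> A \<rightarrow> carrier M"
      using g' A(2) by (auto simp: Pi_iff)
    have "lin_ext M g (\<lambda>p. c p + d p) = (\<Oplus>\<^bsub>M\<^esub>p\<in>A. (c p + d p) \<odot>\<^bsub>M\<^esub> g p)"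
      by (rule lin_ext_superset[OF M A(1) _ gA]) (auto simp: A_def)
    also have "\<dots> = (\<Oplus>\<^bsub>M\<^esub>p\<in>A. c p \<odot>\<^bsub>M\<^esub> g p \<oplus>\<^bsub>M\<^esub> d p \<odot>\<^bsub>M\<^esub> g p)"
      using gA M.smult_l_distr by (intro M.finsum_cong') (auto simp: Pi_iff)
    also have "\<dots> = (\<Oplus>\<^bsub>M\<^esub>p\<in>A. c p \<odot>\<^bsub>M\<^esub> g p) \<oplus>\<^bsub>M\<^esub> (\<Oplus>\<^bsub>M\<^esub>p\<in>A. d p \<odot>\<^bsub>M\<^esub> g p)"
      using gA by (intro M.finsum_addf) (auto simp: Pi_iff)
    also have "(\<Oplus>\<^bsub>M\<^esub>p\<in>A. c p \<odot>\<^bsub>M\<^esub> g p) = lin_ext M g c"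
      by (rule lin_ext_superset[OF M A(1) _ gA, symmetric]) (auto simp: A_def)
    also have "(\<Oplus>\<^bsub>M\<^esub>p\<in>A. d p \<odot>\<^bsub>M\<^esub> g p) = lin_ext M g d"
      by (rule lin_ext_superset[OF M A(1) _ gA, symmetric]) (auto simp: A_def)
    finally show ?thesis .
  qed
  have smult: "lin_ext M g (\<lambda>p. a * c p) = a \<odot>\<^bsub>M\<^esub> lin_ext M g c"
    if c: "c \<in> carrier (symb_space L)" for a c
  proof -
    let ?A = "{p. c p \<noteq> 0}"
    have A: "finite ?A" "?A \<subseteq> carrier L \<times> carrier L"
      using c by (auto simp: symb_space_simps)
    have gA: "g \<in> ?A \<rightarrow> carrier M"
      using g' A(2) by (auto simp: Pi_iff)
    have "lin_ext M g (\<lambda>p. a * c p) = (\<Oplus>\<^bsub>M\<^esub>p\<in>?A. (a * c p) \<odot>\<^bsub>M\<^esub> g p)"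
      by (rule lin_ext_superset[OF M A(1) _ gA]) auto
    also have "\<dots> = (\<Oplus>\<^bsub>M\<^esub>p\<in>?A. a \<odot>\<^bsub>M\<^esub> (c p \<odot>\<^bsub>M\<^esub> g p))"
      using gA M.smult_assoc1 by (intro M.finsum_cong') (auto simp: Pi_iff)
    also have "\<dots> = a \<odot>\<^bsub>M\<^esub> lin_ext M g c"
      unfolding lin_ext_def using gA A(1)
      by (intro M.finsum_smult_ldistr[symmetric]) (auto simp: Pi_iff)
    finally show ?thesis .
  qed
  show ?thesis
    unfolding LinearCombinations.module_hom_def
    using closed add smult by (auto simp: symb_space_simps(3,4))
qed

lemma lin_ext_symb:
  assumes M: "module (class_ring :: complex ring) M" and "g (x, y) \<in> carrier M"
  shows "lin_ext M g (symb x y) = g (x, y)"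
proof -
  interpret M: Module.module "class_ring :: complex ring" M by (rule M)
  have "lin_ext M g (symb x y) = (\<Oplus>\<^bsub>M\<^esub>p\<in>{(x, y)}. symb x y p \<odot>\<^bsub>M\<^esub> g p)"
    using assms by (intro lin_ext_superset) (auto simp: symb_def)
  also have "\<dots> = g (x, y)"
    using assms(2) M.smult_one by (simp add: symb_def)
  finally show ?thesis .
qed

lemma symb_spaceI:
  assumes "finite S" "S \<subseteq> carrier L \<times> carrier L" "\<And>p. p \<notin> S \<Longrightarrow> c p = 0"
  shows "c \<in> carrier (symb_space L)"
proof -
  have "{p. c p \<noteq> 0} \<subseteq> S"
    using assms(3) by auto
  with assms(1,2) show ?thesis
    by (auto simp: symb_space_simps intro: finite_subset)
qed

context lie_algebra
begin

lemma symb_relators_closed: "symb_relators L \<subseteq> carrier (symb_space L)"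
proof -
  have 1: "(\<lambda>p. a * symb x y p + b * symb z w p + c * symb u v p) \<in> carrier (symb_space L)"
    if "x \<in> carrier L" "y \<in> carrier L" "z \<in> carrier L" "w \<in> carrier L"
      "u \<in> carrier L" "v \<in> carrier L" for x y z w u v a b c
    using that by (intro symb_spaceI[of "{(x, y), (z, w), (u, v)}"]) (auto simp: symb_def)
  show ?thesis
    unfolding symb_relators_def
    using 1[of _ _ _ _ _ _ 1 "-1" "-1"] 1[of _ _ _ _ _ _ 1 "-1" 0] 1[of _ _ _ _ _ _ 1 1 1]
      1[of _ _ _ _ _ _ 1 "- a" 0 for a] symb_in_symb_space[of _ L]
    by (auto simp: algebra_simps)
qed

abbreviation coset :: "('a \<times> 'a \<Rightarrow> complex) \<Rightarrow> ('a \<times> 'a \<Rightarrow> complex) set" where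
  "coset c \<equiv> symb_relations L +>\<^bsub>symb_space L\<^esub> c"

lemma relations_submodule: "submodule (class_ring :: complex ring) (symb_relations L) (symb_space L)"
  unfolding symb_relations_def
  by (rule LinearCombinations.module.span_is_submodule[OF symb_space_module symb_relators_closed])

lemma relators_in_relations: "symb_relators L \<subseteq> symb_relations L"
  unfolding symb_relations_def
  by (rule LinearCombinations.module.in_own_span[OF symb_space_module symb_relators_closed])

lemma relations_minimal:
  assumes "submodule (class_ring :: complex ring) N (symb_space L)" "symb_relators L \<subseteq> N"
  shows "symb_relations L \<subseteq> N"
  unfolding symb_relations_def
  by (rule LinearCombinations.module.span_is_subset[OF symb_space_module assms(2,1)])

lemma symb_space_a_inv:
  assumes "c \<in> carrier (symb_space L)"
  shows "\<ominus>\<^bsub>symb_space L\<^esub> c = (\<lambda>p. - c p)"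
proof -
  interpret F: Module.module "class_ring :: complex ring" "symb_space L"
    by (rule symb_space_module)
  have "(\<lambda>p. - c p) \<in> carrier (symb_space L)"
    using symb_space_add_closed[OF assms assms, of "-1" 0] by simp
  then show ?thesis
    using assms by (intro F.minus_equality) (auto simp: symb_space_simps(2,3))
qed

lemma relations_abelian_subgroup: "abelian_subgroup (symb_relations L) (symb_space L)"
proof -
  interpret F: Module.module "class_ring :: complex ring" "symb_space L"
    by (rule symb_space_module)
  interpret R: submodule "class_ring :: complex ring" "symb_relations L" "symb_space L"
    by (rule relations_submodule)
  have "subgroup (symb_relations L) (add_monoid (symb_space L))"
  proof (rule F.add.subgroupI)
    show "symb_relations L \<subseteq> carrier (symb_space L)"
      using R.subset by simp
    show "symb_relations L \<noteq> {}"
      using R.zero_closed by (metis empty_iff)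
    fix c assume c: "c \<in> symb_relations L"
    then have "(- 1) \<odot>\<^bsub>symb_space L\<^esub> c \<in> symb_relations L"
      by (intro R.smult_closed) auto
    then have "\<ominus>\<^bsub>symb_space L\<^esub> c \<in> symb_relations L"
      using c R.subset by (simp add: symb_space_a_inv subset_iff symb_space_simps(4))
    then show "\<ominus>\<^bsub>symb_space L\<^esub> c \<in> symb_relations L" .
  next
    fix c d assume "c \<in> symb_relations L" "d \<in> symb_relations L"
    then show "c \<oplus>\<^bsub>symb_space L\<^esub> d \<in> symb_relations L"
      by simp
  qed
  then show ?thesis
    by (intro abelian_subgroupI3 additive_subgroupI F.abelian_group_axioms)
qed

lemma coset_mem_iff:
  assumes "c \<in> carrier (symb_space L)" "d \<in> carrier (symb_space L)"
  shows "d \<in> coset c \<longleftrightarrow> (\<lambda>p. d p - c p) \<in> symb_relations L"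
proof -
  interpret R: abelian_subgroup "symb_relations L" "symb_space L"
    by (rule relations_abelian_subgroup)
  show ?thesis
    using R.a_rcos_module[OF assms] assms by (simp add: symb_space_a_inv symb_space_simps(3))
qed

lemma coset_subset: "c \<in> carrier (symb_space L) \<Longrightarrow> coset c \<subseteq> carrier (symb_space L)"
  using abelian_subgroup.a_elemrcos_carrier[OF relations_abelian_subgroup] by blast

lemma coset_self: "c \<in> carrier (symb_space L) \<Longrightarrow> c \<in> coset c"
  by (simp add: coset_mem_iff submodule.zero_closed[OF relations_submodule, simplified symb_space_simps])

lemma coset_eqI:
  assumes "c \<in> carrier (symb_space L)" "d \<in> carrier (symb_space L)"
    and "(\<lambda>p. d p - c p) \<in> symb_relations L"
  shows "coset d = coset c"
  using abelian_subgroup.a_repr_independence'[OF relations_abelian_subgroup, of d c]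
    assms coset_mem_iff by blast

lemma carrier_uce: "carrier (uce L) = coset ` carrier (symb_space L)"
  by (auto simp: uce_def Let_def A_RCOSETS_def')

lemma zero_uce: "\<zero>\<^bsub>uce L\<^esub> = coset (\<lambda>p. 0)"
proof -
  interpret R: abelian_subgroup "symb_relations L" "symb_space L"
    by (rule relations_abelian_subgroup)
  show ?thesis
    using R.a_rcos_const[OF submodule.zero_closed[OF relations_submodule]] by (simp add: uce_def Let_def symb_space_simps)
qed

lemma add_uce:
  assumes "c \<in> carrier (symb_space L)" "d \<in> carrier (symb_space L)"
  shows "coset c \<oplus>\<^bsub>uce L\<^esub> coset d = coset (\<lambda>p. c p + d p)"
  using abelian_subgroup.a_rcos_sum[OF relations_abelian_subgroup assms]
  by (simp add: uce_def Let_def symb_space_simps)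

lemma smult_uce:
  assumes c: "c \<in> carrier (symb_space L)"
  shows "a \<odot>\<^bsub>uce L\<^esub> coset c = coset (\<lambda>p. a * c p)"
proof -
  have "coset (\<lambda>p. a * d p) = coset (\<lambda>p. a * c p)" if d: "d \<in> coset c" for d
  proof (rule coset_eqI)
    have d': "d \<in> carrier (symb_space L)"
      using coset_subset[OF c] d by blast
    show "(\<lambda>p. a * c p) \<in> carrier (symb_space L)" "(\<lambda>p. a * d p) \<in> carrier (symb_space L)"
      using symb_space_add_closed[OF c c, of a 0] symb_space_add_closed[OF d' d', of a 0] by simp_all
    have "(\<lambda>p. d p - c p) \<in> symb_relations L"
      using coset_mem_iff[OF c d'] d by simp
    from submodule.smult_closed[OF relations_submodule _ this, of a]
    show "(\<lambda>p. a * d p - a * c p) \<in> symb_relations L"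
      by (simp add: symb_space_simps algebra_simps)
  qed
  moreover have "coset c \<noteq> {}"
    using coset_self[OF c] by (metis empty_iff)
  ultimately have "(\<Union>d\<in>coset c. coset (\<lambda>p. a * d p)) = coset (\<lambda>p. a * c p)"
    by (intro SUP_eq_const)
  then show ?thesis
    by (simp add: uce_def Let_def symb_space_simps(4))
qed

lemma self_module: "Module.module (class_ring :: complex ring) L"
  by unfold_locales

lemma symb_eval_hom: "symb_eval L \<in> LinearCombinations.module_hom class_ring (symb_space L) L"
  unfolding symb_eval_lin_ext by (rule lin_ext_hom[OF self_module]) auto

lemma symb_eval_symb:
  "x \<in> carrier L \<Longrightarrow> y \<in> carrier L \<Longrightarrow> symb_eval L (symb x y) = \<lbrakk>x, y\<rbrakk>\<^bsub>L\<^esub>"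
  unfolding symb_eval_lin_ext by (subst lin_ext_symb[OF self_module]) auto

lemma symb_eval_closed: "c \<in> carrier (symb_space L) \<Longrightarrow> symb_eval L c \<in> carrier L"
  using LinearCombinations.module_hom_closed[OF symb_eval_hom] by blast

text \<open>A bilinear alternating pairing satisfying the cyclic identity extends to the quotient.\<close>

lemma hom_kills_relations:
  assumes M: "Module.module (class_ring :: complex ring) M"
    and f: "f \<in> LinearCombinations.module_hom class_ring (symb_space L) M"
    and fg: "\<And>x y. x \<in> carrier L \<Longrightarrow> y \<in> carrier L \<Longrightarrow> f (symb x y) = g x y"
    and g_add1: "\<And>x y z. x \<in> carrier L \<Longrightarrow> y \<in> carrier L \<Longrightarrow> z \<in> carrier L \<Longrightarrow>
        g (x \<oplus> y) z = g x z \<oplus>\<^bsub>M\<^esub> g y z"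
    and g_add2: "\<And>x y z. x \<in> carrier L \<Longrightarrow> y \<in> carrier L \<Longrightarrow> z \<in> carrier L \<Longrightarrow>
        g x (y \<oplus> z) = g x y \<oplus>\<^bsub>M\<^esub> g x z"
    and g_smult1: "\<And>a x y. x \<in> carrier L \<Longrightarrow> y \<in> carrier L \<Longrightarrow> g (a \<odot> x) y = a \<odot>\<^bsub>M\<^esub> g x y"
    and g_smult2: "\<And>a x y. x \<in> carrier L \<Longrightarrow> y \<in> carrier L \<Longrightarrow> g x (a \<odot> y) = a \<odot>\<^bsub>M\<^esub> g x y"
    and g_self: "\<And>x. x \<in> carrier L \<Longrightarrow> g x x = \<zero>\<^bsub>M\<^esub>"
    and g_cyclic: "\<And>x y z. x \<in> carrier L \<Longrightarrow> y \<in> carrier L \<Longrightarrow> z \<in> carrier L \<Longrightarrow>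
        g x \<lbrakk>y, z\<rbrakk>\<^bsub>L\<^esub> \<oplus>\<^bsub>M\<^esub> g y \<lbrakk>z, x\<rbrakk>\<^bsub>L\<^esub> \<oplus>\<^bsub>M\<^esub> g z \<lbrakk>x, y\<rbrakk>\<^bsub>L\<^esub> = \<zero>\<^bsub>M\<^esub>"
    and c: "c \<in> symb_relations L"
  shows "f c = \<zero>\<^bsub>M\<^esub>"
proof -
  interpret F: Module.module "class_ring :: complex ring" "symb_space L"
    by (rule symb_space_module)
  interpret M: Module.module "class_ring :: complex ring" M
    by (rule M)
  interpret f: mod_hom "class_ring :: complex ring" "symb_space L" M f
    by unfold_locales (rule f)
  have s: "symb x y \<in> carrier (symb_space L)" if "x \<in> carrier L" "y \<in> carrier L" for x y
    using that by (rule symb_in_symb_space)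
  have f_comb: "f (\<lambda>p. a * c p + b * d p) = a \<odot>\<^bsub>M\<^esub> f c \<oplus>\<^bsub>M\<^esub> b \<odot>\<^bsub>M\<^esub> f d"
    if "c \<in> carrier (symb_space L)" "d \<in> carrier (symb_space L)" for a b c d
  proof -
    have "a \<odot>\<^bsub>symb_space L\<^esub> c \<in> carrier (symb_space L)" "b \<odot>\<^bsub>symb_space L\<^esub> d \<in> carrier (symb_space L)"
      using that by (auto intro!: F.smult_closed)
    from f.f_add[OF this] show ?thesis
      using that f.f_smult[of a c] f.f_smult[of b d] by (simp add: symb_space_simps(3,4))
  qed
  have gc: "g x y \<in> carrier M" if "x \<in> carrier L" "y \<in> carrier L" for x y
    using f.f_im[OF s[OF that]] fg that by simp
  have minus: "u \<oplus>\<^bsub>M\<^esub> (- 1) \<odot>\<^bsub>M\<^esub> u = \<zero>\<^bsub>M\<^esub>" if "u \<in> carrier M" for u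
    using M.smult_l_distr[of 1 "- 1" u] M.smult_one[OF that] M.smult_l_null[OF that] that by simp
  have one: "1 \<odot>\<^bsub>M\<^esub> u = u" if "u \<in> carrier M" for u
    using M.smult_one[OF that] by simp
  have "symb_relators L \<subseteq> f.ker"
  proof
    fix c assume c: "c \<in> symb_relators L"
    then have cF: "c \<in> carrier (symb_space L)"
      using symb_relators_closed by blast
    have eq0: "f c = \<zero>\<^bsub>M\<^esub>"
      if "f d = f e" "c = (\<lambda>p. 1 * d p + (- 1) * e p)"
        "d \<in> carrier (symb_space L)" "e \<in> carrier (symb_space L)" for d e
      using that minus[of "f e"] by (simp only: f_comb) (simp add: one)
    have sum2: "f (\<lambda>p. d p + e p) = f d \<oplus>\<^bsub>M\<^esub> f e" "(\<lambda>p. d p + e p) \<in> carrier (symb_space L)"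
      if "d \<in> carrier (symb_space L)" "e \<in> carrier (symb_space L)" for d e
      using f_comb[OF that, of 1 1] symb_space_add_closed[OF that, of 1 1] that
      by (simp_all add: one)
    have smult1: "f (\<lambda>p. a * d p) = a \<odot>\<^bsub>M\<^esub> f d" "(\<lambda>p. a * d p) \<in> carrier (symb_space L)"
      if "d \<in> carrier (symb_space L)" for a d
      using f.f_smult[of a d] symb_space_add_closed[OF that that, of a 0] that
      by (simp_all add: symb_space_simps(4))
    note simps = sum2 smult1 fg s g_add1 g_add2 g_smult1 g_smult2 g_self g_cyclic
    from c have "f c = \<zero>\<^bsub>M\<^esub>"
      unfolding symb_relators_def
    proof (elim UnE CollectE exE conjE, goal_cases)
      case (1 x y z)
      then show ?case
        by (intro eq0[of "symb (x \<oplus> y) z" "\<lambda>p. symb x z p + symb y z p"]) (auto simp: simps)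
    next
      case (2 a x y)
      have "a \<odot> x \<in> carrier L" using 2 by simp
      with 2 show ?case
        by (intro eq0[of "symb (a \<odot> x) y" "\<lambda>p. a * symb x y p"]) (auto simp: simps)
    next
      case (3 x y z)
      then show ?case
        by (intro eq0[of "symb x (y \<oplus> z)" "\<lambda>p. symb x y p + symb x z p"]) (auto simp: simps)
    next
      case (4 a x y)
      have "a \<odot> y \<in> carrier L" using 4 by simp
      with 4 show ?case
        by (intro eq0[of "symb x (a \<odot> y)" "\<lambda>p. a * symb x y p"]) (auto simp: simps)
    next
      case (5 x)
      then show ?case by (simp add: simps)
    next
      case (6 x y z)
      then show ?case by (simp add: simps)
    qed
    with cF show "c \<in> f.ker"
      by (simp add: f.ker_def)
  qed
  with relations_minimal[OF f.ker_is_submodule] c show ?thesis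
    by (auto simp: f.ker_def)
qed

lemma symb_eval_relations: "c \<in> symb_relations L \<Longrightarrow> symb_eval L c = \<zero>"
  by (rule hom_kills_relations[OF self_module symb_eval_hom symb_eval_symb])
    (auto simp: bracket_add_left bracket_add_right bracket_smult_left bracket_smult_right
      bracket_self jacobi)

lemma uceE:
  assumes "X \<in> carrier (uce L)"
  obtains c where "c \<in> carrier (symb_space L)" "X = coset c"
  using assms carrier_uce by blast

lemma coset_closed: "c \<in> carrier (symb_space L) \<Longrightarrow> coset c \<in> carrier (uce L)"
  by (simp add: carrier_uce)

lemma hom_coset:
  assumes M: "Module.module (class_ring :: complex ring) M"
    and f: "f \<in> LinearCombinations.module_hom class_ring (symb_space L) M"
    and kills: "\<And>c. c \<in> symb_relations L \<Longrightarrow> f c = \<zero>\<^bsub>M\<^esub>"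
    and c: "c \<in> carrier (symb_space L)" and d: "d \<in> coset c"
  shows "f d = f c"
proof -
  interpret f: mod_hom "class_ring :: complex ring" "symb_space L" M f
    using symb_space_module M f by (intro mod_hom.intro mod_hom_axioms.intro)
  interpret M: Module.module "class_ring :: complex ring" M
    by (rule M)
  have d': "d \<in> carrier (symb_space L)"
    using coset_subset[OF c] d by blast
  have e: "(\<lambda>p. d p - c p) \<in> symb_relations L"
    using coset_mem_iff[OF c d'] d by simp
  have e': "(\<lambda>p. d p - c p) \<in> carrier (symb_space L)"
    using symb_space_add_closed[OF d' c, of 1 "-1"] by simp
  have "f d = f ((\<lambda>p. d p - c p) \<oplus>\<^bsub>symb_space L\<^esub> c)"
    by (simp add: symb_space_simps(3))
  also have "\<dots> = \<zero>\<^bsub>M\<^esub> \<oplus>\<^bsub>M\<^esub> f c"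
    by (simp only: f.f_add[OF e' c] kills[OF e])
  finally show ?thesis
    using f.f_im[OF c] by simp
qed

lemma the_elem_hom_coset:
  assumes "Module.module (class_ring :: complex ring) M"
    and "f \<in> LinearCombinations.module_hom class_ring (symb_space L) M"
    and "\<And>c. c \<in> symb_relations L \<Longrightarrow> f c = \<zero>\<^bsub>M\<^esub>"
    and c: "c \<in> carrier (symb_space L)"
  shows "the_elem (f ` coset c) = f c"
proof -
  have "f ` coset c = {f c}"
    using coset_self[OF c] hom_coset[OF assms] by (metis image_cong image_constant)
  then show ?thesis
    by simp
qed

lemmas symb_eval_coset = hom_coset[OF self_module symb_eval_hom symb_eval_relations]

lemma uce_proj_coset: "c \<in> carrier (symb_space L) \<Longrightarrow> uce_proj L (coset c) = symb_eval L c"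
  unfolding uce_proj_def
  by (rule the_elem_hom_coset[OF self_module symb_eval_hom symb_eval_relations])

definition pair :: "'a \<Rightarrow> 'a \<Rightarrow> ('a \<times> 'a \<Rightarrow> complex) set" where
  "pair x y = coset (symb x y)"

lemma pair_closed: "x \<in> carrier L \<Longrightarrow> y \<in> carrier L \<Longrightarrow> pair x y \<in> carrier (uce L)"
  by (simp add: pair_def coset_closed symb_in_symb_space)

lemma uce_proj_pair:
  "x \<in> carrier L \<Longrightarrow> y \<in> carrier L \<Longrightarrow> uce_proj L (pair x y) = \<lbrakk>x, y\<rbrakk>\<^bsub>L\<^esub>"
  by (simp add: pair_def uce_proj_coset symb_in_symb_space symb_eval_symb)

lemma bracket_uce:
  assumes X: "X \<in> carrier (uce L)" and Y: "Y \<in> carrier (uce L)"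
  shows "\<lbrakk>X, Y\<rbrakk>\<^bsub>uce L\<^esub> = pair (uce_proj L X) (uce_proj L Y)"
proof -
  obtain c d where c: "c \<in> carrier (symb_space L)" "X = coset c"
    and d: "d \<in> carrier (symb_space L)" "Y = coset d"
    using X Y by (metis uceE)
  have ne: "X \<noteq> {}" "Y \<noteq> {}"
    using coset_self c d by (metis empty_iff)+
  have ev: "symb_eval L a = symb_eval L c" "symb_eval L b = symb_eval L d"
    if "a \<in> X" "b \<in> Y" for a b
    using that c d by (auto dest: symb_eval_coset[rotated])
  have eq: "coset (symb (symb_eval L a) (symb_eval L b)) = pair (symb_eval L c) (symb_eval L d)"
    if "a \<in> X" "b \<in> Y" for a b
    by (simp add: pair_def ev[OF that])
  have "(\<Union>b\<in>Y. coset (symb (symb_eval L a) (symb_eval L b)))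
      = pair (symb_eval L c) (symb_eval L d)" if "a \<in> X" for a
    by (rule SUP_eq_const[OF ne(2) eq[OF that]])
  then have "(\<Union>a\<in>X. \<Union>b\<in>Y. coset (symb (symb_eval L a) (symb_eval L b)))
      = pair (symb_eval L c) (symb_eval L d)"
    by (intro SUP_eq_const[OF ne(1)])
  then show ?thesis
    by (simp add: uce_def Let_def rcoset_mult_def symb_space_simps(5) uce_proj_coset c d)
qed

lemma uce_module: "Module.module (class_ring :: complex ring) (uce L)"
proof -
  note closed = symb_space_add_closed[of _ L _ 1 1, simplified]
    symb_space_add_closed[of _ L _ _ 0, simplified]
  have zero: "(\<lambda>p. 0) \<in> carrier (symb_space L)"
    by (simp add: symb_space_simps)
  note simps = carrier_uce zero_uce add_uce smult_uce closed zero
  show ?thesis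
  proof (rule module_criteria)
    show "cring (class_ring :: complex ring)"
      by (rule class_cring.is_cring)
    show "\<forall>v\<in>carrier (uce L). \<exists>w\<in>carrier (uce L). v \<oplus>\<^bsub>uce L\<^esub> w = \<zero>\<^bsub>uce L\<^esub>"
    proof
      fix v assume "v \<in> carrier (uce L)"
      then obtain c where c: "c \<in> carrier (symb_space L)" "v = coset c"
        by (rule uceE)
      have "(\<lambda>p. - c p) \<in> carrier (symb_space L)"
        using closed(2)[OF c(1) c(1), of "- 1"] by simp
      with c show "\<exists>w\<in>carrier (uce L). v \<oplus>\<^bsub>uce L\<^esub> w = \<zero>\<^bsub>uce L\<^esub>"
        by (intro bexI[of _ "coset (\<lambda>p. - c p)"]) (simp_all add: simps)
    qed
    show "\<forall>v w. v \<in> carrier (uce L) \<and> w \<in> carrier (uce L) \<longrightarrow>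
        v \<oplus>\<^bsub>uce L\<^esub> w = w \<oplus>\<^bsub>uce L\<^esub> v"
      by (intro allI impI, elim conjE uceE) (simp add: add_uce add.commute)
  qed (auto simp: simps algebra_simps)
qed

lemma symb_relators_intros:
  assumes x: "x \<in> carrier L" and y: "y \<in> carrier L" and z: "z \<in> carrier L"
  shows "(\<lambda>p. symb (x \<oplus> y) z p - symb x z p - symb y z p) \<in> symb_relators L"
    and "(\<lambda>p. symb (a \<odot> x) y p - a * symb x y p) \<in> symb_relators L"
    and "(\<lambda>p. symb x (y \<oplus> z) p - symb x y p - symb x z p) \<in> symb_relators L"
    and "(\<lambda>p. symb x (a \<odot> y) p - a * symb x y p) \<in> symb_relators L"
    and "symb x x \<in> symb_relators L"
    and "(\<lambda>p. symb x \<lbrakk>y, z\<rbrakk>\<^bsub>L\<^esub> p + symb y \<lbrakk>z, x\<rbrakk>\<^bsub>L\<^esub> p + symb z \<lbrakk>x, y\<rbrakk>\<^bsub>L\<^esub> p) \<in> symb_relators L"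
  unfolding symb_relators_def
  subgoal
      by (rule UnI1, rule UnI1, rule UnI1, rule UnI1, rule UnI1,
        intro CollectI exI conjI, rule refl, (rule x y z)+)
  subgoal
      by (rule UnI1, rule UnI1, rule UnI1, rule UnI1, rule UnI2,
        intro CollectI exI conjI, rule refl, (rule x y z)+)
  subgoal
      by (rule UnI1, rule UnI1, rule UnI1, rule UnI2,
        intro CollectI exI conjI, rule refl, (rule x y z)+)
  subgoal
      by (rule UnI1, rule UnI1, rule UnI2,
        intro CollectI exI conjI, rule refl, (rule x y z)+)
  subgoal
      by (rule UnI1, rule UnI2,
        intro CollectI exI conjI, rule refl, (rule x)+)
  subgoal
      by (rule UnI2,
        intro CollectI exI conjI, rule refl, (rule x y z)+)
  done

lemma pair_props:
  assumes x: "x \<in> carrier L" and y: "y \<in> carrier L" and z: "z \<in> carrier L"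
  shows pair_add_left: "pair (x \<oplus> y) z = pair x z \<oplus>\<^bsub>uce L\<^esub> pair y z"
    and pair_add_right: "pair x (y \<oplus> z) = pair x y \<oplus>\<^bsub>uce L\<^esub> pair x z"
    and pair_smult_left: "pair (a \<odot> x) y = a \<odot>\<^bsub>uce L\<^esub> pair x y"
    and pair_smult_right: "pair x (a \<odot> y) = a \<odot>\<^bsub>uce L\<^esub> pair x y"
    and pair_self: "pair x x = \<zero>\<^bsub>uce L\<^esub>"
    and pair_cyclic: "pair x \<lbrakk>y, z\<rbrakk>\<^bsub>L\<^esub> \<oplus>\<^bsub>uce L\<^esub> pair y \<lbrakk>z, x\<rbrakk>\<^bsub>L\<^esub> \<oplus>\<^bsub>uce L\<^esub> pair z \<lbrakk>x, y\<rbrakk>\<^bsub>L\<^esub> = \<zero>\<^bsub>uce L\<^esub>"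
proof -
  have s: "symb u v \<in> carrier (symb_space L)" if "u \<in> carrier L" "v \<in> carrier L" for u v
    using that by (rule symb_in_symb_space)
  note sum = symb_space_add_closed[of _ L _ 1 1, simplified]
  have mult: "(\<lambda>p. b * c p) \<in> carrier (symb_space L)" if "c \<in> carrier (symb_space L)" for b c
    using symb_space_add_closed[OF that that, of b 0] by simp
  have c: "x \<oplus> y \<in> carrier L" "y \<oplus> z \<in> carrier L" "a \<odot> x \<in> carrier L" "a \<odot> y \<in> carrier L"
      "\<lbrakk>y, z\<rbrakk>\<^bsub>L\<^esub> \<in> carrier L" "\<lbrakk>z, x\<rbrakk>\<^bsub>L\<^esub> \<in> carrier L" "\<lbrakk>x, y\<rbrakk>\<^bsub>L\<^esub> \<in> carrier L"
    using x y z by auto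
  have zero: "(\<lambda>p. 0) \<in> carrier (symb_space L)"
    by (simp add: symb_space_simps)
  note rel = symb_relators_intros[OF x y z, THEN subsetD[OF relators_in_relations]]
  show "pair (x \<oplus> y) z = pair x z \<oplus>\<^bsub>uce L\<^esub> pair y z"
    unfolding pair_def add_uce[OF s[OF x z] s[OF y z]]
    using rel(1) by (intro coset_eqI sum s x y z c) (simp add: diff_diff_eq)
  show "pair x (y \<oplus> z) = pair x y \<oplus>\<^bsub>uce L\<^esub> pair x z"
    unfolding pair_def add_uce[OF s[OF x y] s[OF x z]]
    using rel(3) by (intro coset_eqI sum s x y z c) (simp add: diff_diff_eq)
  show "pair (a \<odot> x) y = a \<odot>\<^bsub>uce L\<^esub> pair x y"
    unfolding pair_def smult_uce[OF s[OF x y]]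
    by (intro coset_eqI mult s x y z c rel)
  show "pair x (a \<odot> y) = a \<odot>\<^bsub>uce L\<^esub> pair x y"
    unfolding pair_def smult_uce[OF s[OF x y]]
    by (intro coset_eqI mult s x y z c rel)
  show "pair x x = \<zero>\<^bsub>uce L\<^esub>"
    unfolding pair_def zero_uce
    using rel(5) by (intro coset_eqI zero s x) simp
  show "pair x \<lbrakk>y, z\<rbrakk>\<^bsub>L\<^esub> \<oplus>\<^bsub>uce L\<^esub> pair y \<lbrakk>z, x\<rbrakk>\<^bsub>L\<^esub> \<oplus>\<^bsub>uce L\<^esub> pair z \<lbrakk>x, y\<rbrakk>\<^bsub>L\<^esub> = \<zero>\<^bsub>uce L\<^esub>"
    unfolding pair_def zero_uce add_uce[OF s[OF x c(5)] s[OF y c(6)]]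
      add_uce[OF sum[OF s[OF x c(5)] s[OF y c(6)]] s[OF z c(7)]]
    using rel(6) by (intro coset_eqI zero sum s x y z c) simp
qed

lemma uce_proj_hom_module: "uce_proj L \<in> LinearCombinations.module_hom class_ring (uce L) L"
proof -
  note hom = symb_eval_hom[unfolded LinearCombinations.module_hom_def symb_space_simps(3,4)]
  have mult: "(\<lambda>p. b * c p) \<in> carrier (symb_space L)" if "c \<in> carrier (symb_space L)" for b c
    using symb_space_add_closed[OF that that, of b 0] by simp
  note sum = symb_space_add_closed[of _ L _ 1 1, simplified]
  show ?thesis
    unfolding LinearCombinations.module_hom_def
    using hom
    by (auto simp: carrier_uce add_uce smult_uce uce_proj_coset sum mult Pi_iff)
qed

lemma uce_proj_closed: "X \<in> carrier (uce L) \<Longrightarrow> uce_proj L X \<in> carrier L"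
  using LinearCombinations.module_hom_closed[OF uce_proj_hom_module] by blast

lemma uce_proj_bracket:
  "X \<in> carrier (uce L) \<Longrightarrow> Y \<in> carrier (uce L) \<Longrightarrow>
    uce_proj L \<lbrakk>X, Y\<rbrakk>\<^bsub>uce L\<^esub> = \<lbrakk>uce_proj L X, uce_proj L Y\<rbrakk>\<^bsub>L\<^esub>"
  by (simp add: bracket_uce uce_proj_pair uce_proj_closed)

lemma lie_algebra_uce: "lie_algebra (uce L)"
proof -
  interpret U: Module.module "class_ring :: complex ring" "uce L"
    by (rule uce_module)
  have add: "uce_proj L (X \<oplus>\<^bsub>uce L\<^esub> Y) = uce_proj L X \<oplus> uce_proj L Y"
    if "X \<in> carrier (uce L)" "Y \<in> carrier (uce L)" for X Y
    using LinearCombinations.module_hom_add[OF uce_proj_hom_module that] .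
  have smult: "uce_proj L (a \<odot>\<^bsub>uce L\<^esub> X) = a \<odot> uce_proj L X"
    if "X \<in> carrier (uce L)" for a X
    using LinearCombinations.module_hom_smult[OF uce_proj_hom_module _ that] by simp
  show ?thesis
  proof (intro lie_algebra.intro lie_algebra_axioms.intro vectorspace.intro uce_module class_field)
    fix X Y Z assume X: "X \<in> carrier (uce L)" and Y: "Y \<in> carrier (uce L)"
      and Z: "Z \<in> carrier (uce L)"
    note p = X[THEN uce_proj_closed] Y[THEN uce_proj_closed] Z[THEN uce_proj_closed]
    note c = X Y Z U.add.m_closed[OF X Y] U.add.m_closed[OF Y Z]
    show "\<lbrakk>X \<oplus>\<^bsub>uce L\<^esub> Y, Z\<rbrakk>\<^bsub>uce L\<^esub> = \<lbrakk>X, Z\<rbrakk>\<^bsub>uce L\<^esub> \<oplus>\<^bsub>uce L\<^esub> \<lbrakk>Y, Z\<rbrakk>\<^bsub>uce L\<^esub>"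
      by (simp add: bracket_uce c add pair_add_left p)
    show "\<lbrakk>X, Y \<oplus>\<^bsub>uce L\<^esub> Z\<rbrakk>\<^bsub>uce L\<^esub> = \<lbrakk>X, Y\<rbrakk>\<^bsub>uce L\<^esub> \<oplus>\<^bsub>uce L\<^esub> \<lbrakk>X, Z\<rbrakk>\<^bsub>uce L\<^esub>"
      by (simp add: bracket_uce c add pair_add_right p)
    show "\<lbrakk>X, \<lbrakk>Y, Z\<rbrakk>\<^bsub>uce L\<^esub>\<rbrakk>\<^bsub>uce L\<^esub> \<oplus>\<^bsub>uce L\<^esub> \<lbrakk>Y, \<lbrakk>Z, X\<rbrakk>\<^bsub>uce L\<^esub>\<rbrakk>\<^bsub>uce L\<^esub>
        \<oplus>\<^bsub>uce L\<^esub> \<lbrakk>Z, \<lbrakk>X, Y\<rbrakk>\<^bsub>uce L\<^esub>\<rbrakk>\<^bsub>uce L\<^esub> = \<zero>\<^bsub>uce L\<^esub>"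
      by (simp add: bracket_uce c pair_closed uce_proj_pair pair_cyclic p)
  next
    fix X Y and a :: complex
    assume X: "X \<in> carrier (uce L)" and Y: "Y \<in> carrier (uce L)"
    note p = X[THEN uce_proj_closed] Y[THEN uce_proj_closed]
    have c: "a \<odot>\<^bsub>uce L\<^esub> X \<in> carrier (uce L)" "a \<odot>\<^bsub>uce L\<^esub> Y \<in> carrier (uce L)"
      using X Y by (auto intro!: U.smult_closed)
    show "\<lbrakk>X, Y\<rbrakk>\<^bsub>uce L\<^esub> \<in> carrier (uce L)"
      by (simp add: bracket_uce X Y pair_closed p)
    show "\<lbrakk>a \<odot>\<^bsub>uce L\<^esub> X, Y\<rbrakk>\<^bsub>uce L\<^esub> = a \<odot>\<^bsub>uce L\<^esub> \<lbrakk>X, Y\<rbrakk>\<^bsub>uce L\<^esub>"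
      using pair_smult_left[OF p p(1)] by (simp add: bracket_uce X Y c smult)
    show "\<lbrakk>X, a \<odot>\<^bsub>uce L\<^esub> Y\<rbrakk>\<^bsub>uce L\<^esub> = a \<odot>\<^bsub>uce L\<^esub> \<lbrakk>X, Y\<rbrakk>\<^bsub>uce L\<^esub>"
      using pair_smult_right[OF p p(1)] by (simp add: bracket_uce X Y c smult)
  next
    fix X assume X: "X \<in> carrier (uce L)"
    note p = X[THEN uce_proj_closed]
    show "\<lbrakk>X, X\<rbrakk>\<^bsub>uce L\<^esub> = \<zero>\<^bsub>uce L\<^esub>"
      using pair_self[OF p p p] by (simp add: bracket_uce X)
  qed
qed

lemma bracket_zero_left: "x \<in> carrier L \<Longrightarrow> \<lbrakk>\<zero>, x\<rbrakk>\<^bsub>L\<^esub> = \<zero>"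
  using bracket_smult_left[of \<zero> x 0] smult_l_null by simp

lemma bracket_skew:
  assumes x: "x \<in> carrier L" and y: "y \<in> carrier L"
  shows "\<lbrakk>x, y\<rbrakk>\<^bsub>L\<^esub> \<oplus> \<lbrakk>y, x\<rbrakk>\<^bsub>L\<^esub> = \<zero>"
proof -
  have "\<zero> = \<lbrakk>x \<oplus> y, x \<oplus> y\<rbrakk>\<^bsub>L\<^esub>"
    using x y by (intro bracket_self[symmetric]) simp
  also have "\<dots> = (\<lbrakk>x, x\<rbrakk>\<^bsub>L\<^esub> \<oplus> \<lbrakk>y, x\<rbrakk>\<^bsub>L\<^esub>) \<oplus> (\<lbrakk>x, y\<rbrakk>\<^bsub>L\<^esub> \<oplus> \<lbrakk>y, y\<rbrakk>\<^bsub>L\<^esub>)"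
    using x y by (simp add: bracket_add_left bracket_add_right)
  also have "\<dots> = \<lbrakk>y, x\<rbrakk>\<^bsub>L\<^esub> \<oplus> \<lbrakk>x, y\<rbrakk>\<^bsub>L\<^esub>"
    using x y by (simp add: bracket_self)
  also have "\<dots> = \<lbrakk>x, y\<rbrakk>\<^bsub>L\<^esub> \<oplus> \<lbrakk>y, x\<rbrakk>\<^bsub>L\<^esub>"
    using x y by (intro M.add.m_comm) auto
  finally show ?thesis by simp
qed

lemma uce_proj_surj:
  assumes "perfect_lie_algebra L"
  shows "uce_proj L ` carrier (uce L) = carrier L"
proof -
  interpret pr: mod_hom "class_ring :: complex ring" "uce L" L "uce_proj L"
    using uce_module self_module uce_proj_hom_module
    by (intro mod_hom.intro mod_hom_axioms.intro)
  have sub: "submodule class_ring pr.im L"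
    by (rule pr.im_is_submodule)
  have "{\<lbrakk>x, y\<rbrakk>\<^bsub>L\<^esub> | x y. x \<in> carrier L \<and> y \<in> carrier L} \<subseteq> pr.im"
  proof
    fix v assume "v \<in> {\<lbrakk>x, y\<rbrakk>\<^bsub>L\<^esub> | x y. x \<in> carrier L \<and> y \<in> carrier L}"
    then obtain x y where "x \<in> carrier L" "y \<in> carrier L" "v = \<lbrakk>x, y\<rbrakk>\<^bsub>L\<^esub>"
      by (elim CollectE exE conjE)
    then show "v \<in> pr.im"
      unfolding pr.im_def by (intro image_eqI[of _ _ "pair x y"]) (simp_all add: uce_proj_pair pair_closed)
  qed
  then have "carrier (derived_algebra L) \<subseteq> pr.im"
    using LinearCombinations.module.span_is_subset[OF self_module _ sub]
    by (simp add: derived_algebra_def)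
  then show ?thesis
    using assms pr.im_is_submodule submodule.subset[OF sub]
    unfolding perfect_lie_algebra_def pr.im_def by simp
qed

lemma central_extension_uce:
  assumes "perfect_lie_algebra L"
  shows "central_extension (uce L) (uce_proj L) L"
  unfolding central_extension_def
proof (intro conjI ballI impI)
  show "lie_algebra (uce L)" by (rule lie_algebra_uce)
  show "lie_algebra L" by (rule lie_algebra_axioms)
  show "uce_proj L \<in> lie_hom (uce L) L"
    by (simp add: lie_hom_def uce_proj_hom_module uce_proj_bracket)
  show "uce_proj L ` carrier (uce L) = carrier L"
    by (rule uce_proj_surj[OF assms])
  interpret U: lie_algebra "uce L" by (rule lie_algebra_uce)
  fix Z X assume Z: "Z \<in> carrier (uce L)" "uce_proj L Z = \<zero>" and X: "X \<in> carrier (uce L)"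
  have x: "uce_proj L X \<in> carrier L"
    using X by (rule uce_proj_closed)
  have "\<lbrakk>Z, X\<rbrakk>\<^bsub>uce L\<^esub> = pair (0 \<odot> \<zero>) (uce_proj L X)"
    using Z X by (simp add: bracket_uce smult_l_null)
  also have "\<dots> = 0 \<odot>\<^bsub>uce L\<^esub> pair \<zero> (uce_proj L X)"
    using x by (intro pair_smult_left) auto
  also have "\<dots> = \<zero>\<^bsub>uce L\<^esub>"
    using U.smult_l_null pair_closed x by simp
  finally show "\<lbrakk>Z, X\<rbrakk>\<^bsub>uce L\<^esub> = \<zero>\<^bsub>uce L\<^esub>" .
qed

end

lemma lie_homD:
  assumes "\<phi> \<in> lie_hom L M"
  shows "x \<in> carrier L \<Longrightarrow> \<phi> x \<in> carrier M"
    and "x \<in> carrier L \<Longrightarrow> y \<in> carrier L \<Longrightarrow> \<phi> (x \<oplus>\<^bsub>L\<^esub> y) = \<phi> x \<oplus>\<^bsub>M\<^esub> \<phi> y"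
    and "x \<in> carrier L \<Longrightarrow> \<phi> (a \<odot>\<^bsub>L\<^esub> x) = a \<odot>\<^bsub>M\<^esub> \<phi> x"
    and "x \<in> carrier L \<Longrightarrow> y \<in> carrier L \<Longrightarrow> \<phi> \<lbrakk>x, y\<rbrakk>\<^bsub>L\<^esub> = \<lbrakk>\<phi> x, \<phi> y\<rbrakk>\<^bsub>M\<^esub>"
  using assms
  by (auto simp: lie_hom_def LinearCombinations.module_hom_def Pi_iff)

lemma central_bracket_cong:
  assumes ext: "central_extension E \<rho> L"
    and e: "e \<in> carrier E" "e' \<in> carrier E" "\<rho> e = \<rho> e'"
    and f: "f \<in> carrier E" "f' \<in> carrier E" "\<rho> f = \<rho> f'"
  shows "\<lbrakk>e, f\<rbrakk>\<^bsub>E\<^esub> = \<lbrakk>e', f'\<rbrakk>\<^bsub>E\<^esub>"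
proof -
  interpret E: lie_algebra E
    using ext by (simp add: central_extension_def)
  interpret L: lie_algebra L
    using ext by (simp add: central_extension_def)
  note \<rho> = lie_homD[of \<rho> E L]
  have \<rho>_hom: "\<rho> \<in> lie_hom E L"
    using ext by (simp add: central_extension_def)
  have diff: "\<exists>z\<in>carrier E. u = v \<oplus>\<^bsub>E\<^esub> z \<and> (\<forall>x\<in>carrier E. \<lbrakk>z, x\<rbrakk>\<^bsub>E\<^esub> = \<zero>\<^bsub>E\<^esub>)"
    if u: "u \<in> carrier E" and v: "v \<in> carrier E" and uv: "\<rho> u = \<rho> v" for u v
  proof -
    define z where "z = (- 1) \<odot>\<^bsub>E\<^esub> v \<oplus>\<^bsub>E\<^esub> u"
    have neg: "(- 1) \<odot>\<^bsub>E\<^esub> w = \<ominus>\<^bsub>E\<^esub> w" if "w \<in> carrier E" for w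
      using E.smult_minus_1[OF that] by (simp add: class_ring_simps)
    have negL: "(- 1) \<odot>\<^bsub>L\<^esub> w = \<ominus>\<^bsub>L\<^esub> w" if "w \<in> carrier L" for w
      using L.smult_minus_1[OF that] by (simp add: class_ring_simps)
    have mv: "(- 1) \<odot>\<^bsub>E\<^esub> v \<in> carrier E"
      using v by auto
    have z: "z \<in> carrier E"
      unfolding z_def using mv u by simp
    have "\<rho> z = (- 1) \<odot>\<^bsub>L\<^esub> \<rho> v \<oplus>\<^bsub>L\<^esub> \<rho> v"
      unfolding z_def using \<rho>(2)[OF \<rho>_hom mv u] \<rho>(3)[OF \<rho>_hom v] uv by simp
    also have "\<dots> = \<zero>\<^bsub>L\<^esub>"
      using negL \<rho>(1)[OF \<rho>_hom v] by (simp add: L.M.l_neg)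
    finally have "\<forall>x\<in>carrier E. \<lbrakk>z, x\<rbrakk>\<^bsub>E\<^esub> = \<zero>\<^bsub>E\<^esub>"
      using ext z by (auto simp: central_extension_def)
    moreover have "u = v \<oplus>\<^bsub>E\<^esub> z"
      unfolding z_def neg[OF v] using u v by (simp add: E.M.r_neg flip: E.M.a_assoc)
    ultimately show ?thesis
      using z by blast
  qed
  obtain z where z: "z \<in> carrier E" "e = e' \<oplus>\<^bsub>E\<^esub> z" "\<forall>x\<in>carrier E. \<lbrakk>z, x\<rbrakk>\<^bsub>E\<^esub> = \<zero>\<^bsub>E\<^esub>"
    using diff[OF e] by blast
  obtain w where w: "w \<in> carrier E" "f = f' \<oplus>\<^bsub>E\<^esub> w" "\<forall>x\<in>carrier E. \<lbrakk>w, x\<rbrakk>\<^bsub>E\<^esub> = \<zero>\<^bsub>E\<^esub>"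
    using diff[OF f] by blast
  have w': "\<lbrakk>e', w\<rbrakk>\<^bsub>E\<^esub> = \<zero>\<^bsub>E\<^esub>"
    using E.bracket_skew[OF e(2) w(1)] w e by simp
  have "\<lbrakk>e, f\<rbrakk>\<^bsub>E\<^esub> = \<lbrakk>e', f\<rbrakk>\<^bsub>E\<^esub>"
    unfolding z(2) E.bracket_add_left[OF e(2) z(1) f(1)] using z f e by simp
  also have "\<dots> = \<lbrakk>e', f'\<rbrakk>\<^bsub>E\<^esub>"
    unfolding w(2) E.bracket_add_right[OF e(2) f(2) w(1)] using w' f e by simp
  finally show ?thesis .
qed

context lie_algebra
begin

lemma uce_lift:
  assumes ext: "central_extension E \<rho> L"
  shows "\<exists>\<phi>\<in>lie_hom (uce L) E. \<forall>X\<in>carrier (uce L). \<rho> (\<phi> X) = uce_proj L X"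
proof -
  interpret E: lie_algebra E
    using ext by (simp add: central_extension_def)
  have \<rho>_hom: "\<rho> \<in> lie_hom E L"
    using ext by (simp add: central_extension_def)
  note \<rho> = lie_homD[OF \<rho>_hom]
  define s where "s x = (SOME e. e \<in> carrier E \<and> \<rho> e = x)" for x
  have s: "s x \<in> carrier E" "\<rho> (s x) = x" if x: "x \<in> carrier L" for x
  proof -
    have "x \<in> \<rho> ` carrier E"
      using ext x by (simp add: central_extension_def)
    then have "\<exists>e. e \<in> carrier E \<and> \<rho> e = x"
      by (elim imageE) (rule exI, simp)
    then have "s x \<in> carrier E \<and> \<rho> (s x) = x"
      unfolding s_def by (rule someI_ex)
    then show "s x \<in> carrier E" "\<rho> (s x) = x" by simp_all
  qed
  note cong = central_bracket_cong[OF ext]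
  define g where "g x y = \<lbrakk>s x, s y\<rbrakk>\<^bsub>E\<^esub>" for x y
  define f where "f = lin_ext E (\<lambda>p. g (fst p) (snd p))"
  have g_closed: "g x y \<in> carrier E" if "x \<in> carrier L" "y \<in> carrier L" for x y
    using that by (simp add: g_def s)
  have f_hom: "f \<in> LinearCombinations.module_hom class_ring (symb_space L) E"
    unfolding f_def by (rule lin_ext_hom[OF E.self_module]) (auto simp: g_closed)
  have f_symb: "f (symb x y) = g x y" if "x \<in> carrier L" "y \<in> carrier L" for x y
    unfolding f_def using that by (subst lin_ext_symb[OF E.self_module]) (auto simp: g_closed)
  have sc: "x \<oplus> y \<in> carrier L" "a \<odot> x \<in> carrier L" "\<lbrakk>x, y\<rbrakk>\<^bsub>L\<^esub> \<in> carrier L"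
      "a \<odot>\<^bsub>E\<^esub> s x \<in> carrier E"
    if "x \<in> carrier L" "y \<in> carrier L" for x y a
    using that s by auto
  have g_eq: "g x y = \<lbrakk>e, e'\<rbrakk>\<^bsub>E\<^esub>"
    if "x \<in> carrier L" "y \<in> carrier L" "e \<in> carrier E" "e' \<in> carrier E" "\<rho> e = x" "\<rho> e' = y"
    for x y e e'
    unfolding g_def using that by (intro cong) (simp_all add: s)
  have kills: "f c = \<zero>\<^bsub>E\<^esub>" if c: "c \<in> symb_relations L" for c
  proof (rule hom_kills_relations[OF E.self_module f_hom f_symb _ _ _ _ _ _ c])
    fix x y z assume x: "x \<in> carrier L" and y: "y \<in> carrier L" and z: "z \<in> carrier L"
    note S = s(1)[OF x] s(1)[OF y] s(1)[OF z]
    have "g (x \<oplus> y) z = \<lbrakk>s x \<oplus>\<^bsub>E\<^esub> s y, s z\<rbrakk>\<^bsub>E\<^esub>"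
      using x y z by (intro g_eq) (simp_all add: s \<rho>)
    then show "g (x \<oplus> y) z = g x z \<oplus>\<^bsub>E\<^esub> g y z"
      by (simp add: g_def E.bracket_add_left S)
    have "g x (y \<oplus> z) = \<lbrakk>s x, s y \<oplus>\<^bsub>E\<^esub> s z\<rbrakk>\<^bsub>E\<^esub>"
      using x y z by (intro g_eq) (simp_all add: s \<rho>)
    then show "g x (y \<oplus> z) = g x y \<oplus>\<^bsub>E\<^esub> g x z"
      by (simp add: g_def E.bracket_add_right S)
    have "g u \<lbrakk>v, w\<rbrakk>\<^bsub>L\<^esub> = \<lbrakk>s u, \<lbrakk>s v, s w\<rbrakk>\<^bsub>E\<^esub>\<rbrakk>\<^bsub>E\<^esub>"
      if "u \<in> carrier L" "v \<in> carrier L" "w \<in> carrier L" for u v w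
      using that by (intro g_eq) (simp_all add: s \<rho>)
    then show "g x \<lbrakk>y, z\<rbrakk>\<^bsub>L\<^esub> \<oplus>\<^bsub>E\<^esub> g y \<lbrakk>z, x\<rbrakk>\<^bsub>L\<^esub> \<oplus>\<^bsub>E\<^esub> g z \<lbrakk>x, y\<rbrakk>\<^bsub>L\<^esub> = \<zero>\<^bsub>E\<^esub>"
      using x y z by (simp add: E.jacobi S)
  next
    fix x y and a :: complex assume x: "x \<in> carrier L" and y: "y \<in> carrier L"
    note S = s(1)[OF x] s(1)[OF y]
    have "g (a \<odot> x) y = \<lbrakk>a \<odot>\<^bsub>E\<^esub> s x, s y\<rbrakk>\<^bsub>E\<^esub>"
      using x y sc by (intro g_eq) (simp_all add: s \<rho>)
    then show "g (a \<odot> x) y = a \<odot>\<^bsub>E\<^esub> g x y"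
      by (simp add: g_def E.bracket_smult_left S)
    have "g x (a \<odot> y) = \<lbrakk>s x, a \<odot>\<^bsub>E\<^esub> s y\<rbrakk>\<^bsub>E\<^esub>"
      using x y sc by (intro g_eq) (simp_all add: s \<rho>)
    then show "g x (a \<odot> y) = a \<odot>\<^bsub>E\<^esub> g x y"
      by (simp add: g_def E.bracket_smult_right S)
  next
    fix x assume "x \<in> carrier L"
    then show "g x x = \<zero>\<^bsub>E\<^esub>"
      by (simp add: g_def E.bracket_self s)
  qed
  define \<phi> where "\<phi> X = the_elem (f ` X)" for X
  have \<phi>_coset: "\<phi> (coset c) = f c" if "c \<in> carrier (symb_space L)" for c
    unfolding \<phi>_def by (rule the_elem_hom_coset[OF E.self_module f_hom kills that])
  have \<phi>_module: "\<phi> \<in> LinearCombinations.module_hom class_ring (uce L) E"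
  proof -
    note hom = f_hom[unfolded LinearCombinations.module_hom_def symb_space_simps(3,4)]
    have mult: "(\<lambda>p. b * c p) \<in> carrier (symb_space L)" if "c \<in> carrier (symb_space L)" for b c
      using symb_space_add_closed[OF that that, of b 0] by simp
    note sum = symb_space_add_closed[of _ L _ 1 1, simplified]
    show ?thesis
      unfolding LinearCombinations.module_hom_def
      using hom
      by (auto simp: carrier_uce add_uce smult_uce \<phi>_coset sum mult Pi_iff)
  qed
  interpret f: mod_hom "class_ring :: complex ring" "symb_space L" E f
    using symb_space_module E.self_module f_hom by (intro mod_hom.intro mod_hom_axioms.intro)
  interpret ev: mod_hom "class_ring :: complex ring" "symb_space L" L "symb_eval L"
    using symb_space_module self_module symb_eval_hom by (intro mod_hom.intro mod_hom_axioms.intro)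
  have \<rho>f: "\<rho> (f c) = symb_eval L c" if c: "c \<in> carrier (symb_space L)" for c
  proof -
    have "c \<in> {c \<in> carrier (symb_space L). \<rho> (f c) = symb_eval L c}" (is "_ \<in> ?N")
    proof (rule symb_space_eqI[OF _ _ c])
      have "\<zero>\<^bsub>symb_space L\<^esub> \<in> carrier (symb_space L)"
        by (simp add: symb_space_simps)
      moreover have "\<rho> \<zero>\<^bsub>E\<^esub> = \<zero>"
        using \<rho>(3)[of "\<zero>\<^bsub>E\<^esub>" 0] E.smult_l_null[of "\<zero>\<^bsub>E\<^esub>"] smult_l_null[OF \<rho>(1), of "\<zero>\<^bsub>E\<^esub>"] by simp
      ultimately show "submodule class_ring ?N (symb_space L)"
        using symb_space_module[of L] f.f_im \<rho>
        by (intro submodule.intro) (auto intro: Module.module.smult_closed)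
      fix x y assume x: "x \<in> carrier L" and y: "y \<in> carrier L"
      then show "symb x y \<in> ?N"
        by (simp add: symb_in_symb_space f_symb symb_eval_symb g_def \<rho> s)
    qed
    then show ?thesis by simp
  qed
  have \<rho>\<phi>: "\<rho> (\<phi> X) = uce_proj L X" if "X \<in> carrier (uce L)" for X
    using that by (elim uceE) (simp add: \<phi>_coset \<rho>f uce_proj_coset)
  have \<phi>_closed: "\<phi> X \<in> carrier E" if "X \<in> carrier (uce L)" for X
    using LinearCombinations.module_hom_closed[OF \<phi>_module] that by (rule funcset_mem)
  have "\<phi> \<lbrakk>X, Y\<rbrakk>\<^bsub>uce L\<^esub> = \<lbrakk>\<phi> X, \<phi> Y\<rbrakk>\<^bsub>E\<^esub>"
    if X: "X \<in> carrier (uce L)" and Y: "Y \<in> carrier (uce L)" for X Y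
  proof -
    note p = uce_proj_closed[OF X] uce_proj_closed[OF Y]
    have "\<phi> \<lbrakk>X, Y\<rbrakk>\<^bsub>uce L\<^esub> = g (uce_proj L X) (uce_proj L Y)"
      by (simp add: bracket_uce X Y pair_def \<phi>_coset symb_in_symb_space p f_symb)
    also have "\<dots> = \<lbrakk>\<phi> X, \<phi> Y\<rbrakk>\<^bsub>E\<^esub>"
      using X Y p by (intro g_eq) (simp_all add: \<rho>\<phi> \<phi>_closed)
    finally show ?thesis .
  qed
  with \<phi>_module \<rho>\<phi> show ?thesis
    by (intro bexI[of _ \<phi>]) (simp_all add: lie_hom_def)
qed

lemma uce_lift_unique:
  assumes perfect: "perfect_lie_algebra L"
    and ext: "central_extension E \<rho> L"
    and \<phi>: "\<phi> \<in> lie_hom (uce L) E" "\<forall>X\<in>carrier (uce L). \<rho> (\<phi> X) = uce_proj L X"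
    and \<psi>: "\<psi> \<in> lie_hom (uce L) E" "\<forall>X\<in>carrier (uce L). \<rho> (\<psi> X) = uce_proj L X"
    and X: "X \<in> carrier (uce L)"
  shows "\<psi> X = \<phi> X"
proof -
  note H\<phi> = lie_homD[OF \<phi>(1)] and H\<psi> = lie_homD[OF \<psi>(1)]
  interpret E: lie_algebra E
    using ext by (simp add: central_extension_def)
  have pair: "\<psi> (pair x y) = \<phi> (pair x y)" if x: "x \<in> carrier L" and y: "y \<in> carrier L" for x y
  proof -
    have "x \<in> uce_proj L ` carrier (uce L)" "y \<in> uce_proj L ` carrier (uce L)"
      using uce_proj_surj[OF perfect] x y by simp_all
    then obtain A B where A: "A \<in> carrier (uce L)" "uce_proj L A = x"
      and B: "B \<in> carrier (uce L)" "uce_proj L B = y"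
      by (elim imageE) simp
    have "pair x y = \<lbrakk>A, B\<rbrakk>\<^bsub>uce L\<^esub>"
      by (simp add: bracket_uce A B)
    moreover have "\<lbrakk>\<psi> A, \<psi> B\<rbrakk>\<^bsub>E\<^esub> = \<lbrakk>\<phi> A, \<phi> B\<rbrakk>\<^bsub>E\<^esub>"
      using A(1) B(1) \<phi>(2) \<psi>(2) H\<phi>(1) H\<psi>(1) by (intro central_bracket_cong[OF ext]) simp_all
    ultimately show ?thesis
      using A(1) B(1) by (simp add: H\<phi>(4) H\<psi>(4))
  qed
  obtain c where c: "c \<in> carrier (symb_space L)" "X = coset c"
    using X by (rule uceE)
  have "c \<in> {c \<in> carrier (symb_space L). \<psi> (coset c) = \<phi> (coset c)}" (is "_ \<in> ?N")
  proof (rule symb_space_eqI[OF _ _ c(1)])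
    have sum: "\<psi> (coset (\<lambda>p. c p + d p)) = \<phi> (coset (\<lambda>p. c p + d p))"
      if "c \<in> ?N" "d \<in> ?N" for c d
    proof -
      have "c \<in> carrier (symb_space L)" "d \<in> carrier (symb_space L)"
        using that by simp_all
      note cd = add_uce[OF this, symmetric] this[THEN coset_closed]
      show ?thesis
        using that cd(2,3) by (simp add: cd(1) H\<phi>(2) H\<psi>(2))
    qed
    have mult: "\<psi> (coset (\<lambda>p. a * c p)) = \<phi> (coset (\<lambda>p. a * c p))" if "c \<in> ?N" for a c
    proof -
      have "c \<in> carrier (symb_space L)"
        using that by simp
      note cd = smult_uce[OF this, symmetric] this[THEN coset_closed]
      show ?thesis
        using that cd(2) by (simp add: cd(1) H\<phi>(3) H\<psi>(3))
    qed
    have z: "(\<lambda>p. 0) \<in> carrier (symb_space L)"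
      by (simp add: symb_space_simps)
    have zz: "coset (\<lambda>p. 0) = coset (\<lambda>p. 0 * (0::complex))"
      by simp
    have "\<phi> (coset (\<lambda>p. 0)) = 0 \<odot>\<^bsub>E\<^esub> \<phi> (coset (\<lambda>p. 0))" "\<psi> (coset (\<lambda>p. 0)) = 0 \<odot>\<^bsub>E\<^esub> \<psi> (coset (\<lambda>p. 0))"
      using H\<phi>(3)[OF coset_closed[OF z], of 0] H\<psi>(3)[OF coset_closed[OF z], of 0]
      by (simp_all add: smult_uce[OF z])
    then have zero: "\<psi> (coset (\<lambda>p. 0)) = \<phi> (coset (\<lambda>p. 0))"
      using E.smult_l_null[OF H\<phi>(1)[OF coset_closed[OF z]]]
        E.smult_l_null[OF H\<psi>(1)[OF coset_closed[OF z]]] by simp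
    show "submodule class_ring ?N (symb_space L)"
    proof (rule submodule.intro)
      show "module class_ring (symb_space L)"
        by (rule symb_space_module)
      show "?N \<subseteq> carrier (symb_space L)"
        by simp
      show "\<zero>\<^bsub>symb_space L\<^esub> \<in> ?N"
        using z zero by (simp add: symb_space_simps(2))
      show "v \<oplus>\<^bsub>symb_space L\<^esub> w \<in> ?N" if "v \<in> ?N" "w \<in> ?N" for v w
        using sum[OF that] that symb_space_add_closed[of v L w 1 1]
        by (simp add: symb_space_simps(3))
      show "a \<odot>\<^bsub>symb_space L\<^esub> v \<in> ?N" if "v \<in> ?N" for a v
        using mult[OF that] that symb_space_add_closed[of v L v a 0]
        by (simp add: symb_space_simps(4))
    qed
    fix x y assume "x \<in> carrier L" "y \<in> carrier L"
    then show "symb x y \<in> ?N"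
      using pair by (simp add: symb_in_symb_space pair_def)
  qed
  then show ?thesis
    using c by simp
qed

end

theorem uce_universal:
  assumes "perfect_lie_algebra L"
  shows "universal_central_extension TYPE('e) (uce L) (uce_proj L) L"
proof -
  interpret lie_algebra L
    using assms by (simp add: perfect_lie_algebra_def)
  show ?thesis
    unfolding universal_central_extension_def
  proof (intro conjI allI impI)
    show "central_extension (uce L) (uce_proj L) L"
      by (rule central_extension_uce[OF assms])
    fix E :: "'e lie_alg" and \<rho>
    assume ext: "central_extension E \<rho> L"
    obtain \<phi> where \<phi>: "\<phi> \<in> lie_hom (uce L) E" "\<forall>X\<in>carrier (uce L). \<rho> (\<phi> X) = uce_proj L X"
      using uce_lift[OF ext] by (elim bexE)
    show "\<exists>\<phi>\<in>lie_hom (uce L) E. (\<forall>X\<in>carrier (uce L). \<rho> (\<phi> X) = uce_proj L X)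
        \<and> (\<forall>\<psi>\<in>lie_hom (uce L) E. (\<forall>X\<in>carrier (uce L). \<rho> (\<psi> X) = uce_proj L X) \<longrightarrow>
             (\<forall>X\<in>carrier (uce L). \<psi> X = \<phi> X))"
      by (intro bexI[of _ \<phi>] conjI ballI impI uce_lift_unique[OF assms ext \<phi>])
        (use \<phi> in simp_all)
  qed
qed

end

theory Submission
  imports Defs
begin

text \<open>
  Perfect central extensions do not change the universal central extension: if
  \<open>\<pi> : E \<rightarrow> L\<close> is one, then \<open>\<langle>z, [a, b]\<rangle> = - \<langle>a, [b, z]\<rangle> - \<langle>b, [z, a]\<rangle> = 0\<close> in \<open>uce E\<close> for \<open>z\<close> in
  \<open>ker \<pi>\<close>, so \<open>\<langle>x, y\<rangle>\<close> depends only on \<open>\<pi> x\<close> and \<open>\<pi> y\<close>. The derived algebra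
  \<open>\<gg>' = \<gg>\<^sub>0[t\<^sup>\<plusminus>\<^sup>1] \<oplus> \<complex>c\<close> is perfect and centrally extends \<open>\<gg>\<^sub>0[t\<^sup>\<plusminus>\<^sup>1]\<close>. Tensoring with the monoid algebra
  of \<open>\<nat>\<close> or \<open>\<int>\<close> preserves both properties, and the base becomes the algebra in two variables.
\<close>

text \<open>That \<open>\<langle>x, y\<rangle>\<close> depends only on \<open>\<pi> x\<close> and
  \<open>\<pi> y\<close> does not by itself give a homomorphism from \<open>uce L\<close> to
  \<open>uce E\<close>, since elements of L have no canonical preimages. The vanishing on the kernel
  is used in another form: it says that the composite of \<open>uce E\<close>, E and L is again a
  central extension, which fails for composites of central extensions in general. The lifting
  property of \<open>uce L\<close> then supplies the map, and its inverse is induced by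
  \<open>\<pi>\<close> on symbols. The affine algebra is given only up to an isomorphism onto the
  coordinate model \<open>affine_lie\<close>, and it is the given algebra, not the model, that comes
  with the Lie algebra laws. Perfectness and centrality of the derived algebra are therefore proved
  inside the given algebra, and the isomorphism serves to read off coordinates. The bracket over a
  monoid algebra is a convolution whose summation range depends on both supports; its identities are
  obtained from monomials by multilinearity.\<close>

context lie_algebra
begin

section \<open>Perfectness as generation by brackets\<close>

lemma smult_simps:
  assumes "x \<in> carrier L"
  shows "1 \<odot> x = x" "0 \<odot> x = \<zero>"
    "(a + b) \<odot> x = a \<odot> x \<oplus> b \<odot> x" "(a * b) \<odot> x = a \<odot> (b \<odot> x)"
  using smult_one[OF assms] smult_l_null[OF assms] smult_l_distr[of a b x] smult_assoc1[of a b x]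
    assms by simp_all

lemma bracket_zero_right: "x \<in> carrier L \<Longrightarrow> \<lbrakk>x, \<zero>\<rbrakk>\<^bsub>L\<^esub> = \<zero>"
  using bracket_smult_right[of x \<zero> 0] smult_l_null by simp

lemma brackets_closed: "{\<lbrakk>x, y\<rbrakk>\<^bsub>L\<^esub> | x y. x \<in> carrier L \<and> y \<in> carrier L} \<subseteq> carrier L"
  by auto

lemma carrier_derived: "carrier (derived_algebra L) =
    span {\<lbrakk>x, y\<rbrakk>\<^bsub>L\<^esub> | x y. x \<in> carrier L \<and> y \<in> carrier L}"
  by (simp add: derived_algebra_def)

text \<open>The span of the brackets is itself one of the submodules N, so the hypothesis can be
  applied to it; no linear combination has to be written down.\<close>

lemma perfectI:
  assumes "\<And>N. submodule (class_ring :: complex ring) N L \<Longrightarrow>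
      (\<And>x y. x \<in> carrier L \<Longrightarrow> y \<in> carrier L \<Longrightarrow> \<lbrakk>x, y\<rbrakk>\<^bsub>L\<^esub> \<in> N) \<Longrightarrow> carrier L \<subseteq> N"
  shows "perfect_lie_algebra L"
proof -
  let ?B = "{\<lbrakk>x, y\<rbrakk>\<^bsub>L\<^esub> | x y. x \<in> carrier L \<and> y \<in> carrier L}"
  have sub: "submodule (class_ring :: complex ring) (span ?B) L"
    by (rule span_is_submodule[OF brackets_closed])
  moreover have "\<lbrakk>x, y\<rbrakk>\<^bsub>L\<^esub> \<in> span ?B" if "x \<in> carrier L" "y \<in> carrier L" for x y
    using in_own_span[OF brackets_closed] that by blast
  ultimately have "carrier L \<subseteq> span ?B"
    by (rule assms)
  then have "span ?B = carrier L"
    using submodule.subset[OF sub] by (rule subset_antisym[rotated])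
  then show ?thesis
    unfolding perfect_lie_algebra_def carrier_derived by (rule conjI[OF lie_algebra_axioms])
qed

text \<open>The form in which perfectness is used: a property whose solution set is a submodule has
  to be checked on brackets only.\<close>

lemma perfect_induct:
  assumes perfect: "perfect_lie_algebra L"
    and N: "submodule (class_ring :: complex ring) N L"
    and bracket: "\<And>x y. x \<in> carrier L \<Longrightarrow> y \<in> carrier L \<Longrightarrow> \<lbrakk>x, y\<rbrakk>\<^bsub>L\<^esub> \<in> N"
    and x: "x \<in> carrier L"
  shows "x \<in> N"
proof -
  have "{\<lbrakk>x, y\<rbrakk>\<^bsub>L\<^esub> | x y. x \<in> carrier L \<and> y \<in> carrier L} \<subseteq> N"
    using bracket by auto
  from span_is_subset[OF this N] show ?thesis
    using x perfect unfolding perfect_lie_algebra_def carrier_derived by blast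
qed

end

text \<open>The derived algebra is an ideal, and it is nonzero because some bracket is nonzero;
  simplicity leaves only the whole algebra.\<close>

lemma simple_imp_perfect:
  assumes "simple_lie_algebra L"
  shows "perfect_lie_algebra L"
proof -
  interpret lie_algebra L
    using assms by (simp add: simple_lie_algebra_def)
  let ?D = "carrier (derived_algebra L)"
  let ?B = "{\<lbrakk>x, y\<rbrakk>\<^bsub>L\<^esub> | x y. x \<in> carrier L \<and> y \<in> carrier L}"
  have D: "?D = span ?B"
    by (rule carrier_derived)
  have sub: "submodule (class_ring :: complex ring) ?D L"
    unfolding D by (rule span_is_submodule[OF brackets_closed])
  have bracket: "\<lbrakk>x, y\<rbrakk>\<^bsub>L\<^esub> \<in> ?D" if "x \<in> carrier L" "y \<in> carrier L" for x y
    unfolding D using in_own_span[OF brackets_closed] that by blast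
  have "subspace (class_ring :: complex ring) ?D L"
    using sub vectorspace_axioms by (simp add: subspace_def)
  then have "lie_ideal ?D L"
    unfolding lie_ideal_def using bracket submodule.subset[OF sub] by blast
  moreover have "?D \<noteq> {\<zero>\<^bsub>L\<^esub>}"
    using assms bracket by (force simp: simple_lie_algebra_def)
  ultimately have "?D = carrier L"
    using assms unfolding simple_lie_algebra_def by blast
  then show ?thesis
    by (simp add: perfect_lie_algebra_def lie_algebra_axioms)
qed

section \<open>Lie algebras over a monoid algebra\<close>

text \<open>The element \<open>x \<otimes> t^m\<close>.\<close>

definition monomial :: "'a lie_alg \<Rightarrow> 'm \<Rightarrow> 'a \<Rightarrow> 'm \<Rightarrow> 'a" where
  "monomial L m x = (\<lambda>n. if n = m then x else \<zero>\<^bsub>L\<^esub>)"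

text \<open>The monoid is read off from the type, which keeps iterated extensions such as
  \<open>mext (mext L)\<close> legible.\<close>

abbreviation (input) mext :: "'a lie_alg \<Rightarrow> ('m::comm_monoid_add \<Rightarrow> 'a) lie_alg" where
  "mext \<equiv> monoid_extension TYPE('m)"

lemma mext_simps:
  "f \<in> carrier (mext L) \<longleftrightarrow> (\<forall>m. f m \<in> carrier L) \<and> finite {m. f m \<noteq> \<zero>\<^bsub>L\<^esub>}"
  "\<zero>\<^bsub>mext L\<^esub> = (\<lambda>m. \<zero>\<^bsub>L\<^esub>)"
  "f \<oplus>\<^bsub>mext L\<^esub> g = (\<lambda>m. f m \<oplus>\<^bsub>L\<^esub> g m)"
  "a \<odot>\<^bsub>mext L\<^esub> f = (\<lambda>m. a \<odot>\<^bsub>L\<^esub> f m)"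
  "\<lbrakk>f, g\<rbrakk>\<^bsub>mext L\<^esub> = (\<lambda>m. \<Oplus>\<^bsub>L\<^esub>p\<in>{(i, j). f i \<noteq> \<zero>\<^bsub>L\<^esub> \<and> g j \<noteq> \<zero>\<^bsub>L\<^esub> \<and> i + j = m}.
              \<lbrakk>f (fst p), g (snd p)\<rbrakk>\<^bsub>L\<^esub>)"
  for f g :: "'m::comm_monoid_add \<Rightarrow> 'a"
  by (auto simp: monoid_extension_def)

section \<open>Lie algebra structure and perfectness of a monoid extension\<close>

context lie_algebra
begin

lemma mext_module: "Module.module (class_ring :: complex ring) (mext L :: ('m::comm_monoid_add \<Rightarrow> 'a) lie_alg)"
proof (rule module_criteria)
  let ?E = "mext L :: ('m \<Rightarrow> 'a) lie_alg"
  show "cring (class_ring :: complex ring)"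
    by (rule class_cring.is_cring)
  show "\<zero>\<^bsub>?E\<^esub> \<in> carrier ?E"
    by (simp add: mext_simps)
  show "\<forall>v w. v \<in> carrier ?E \<and> w \<in> carrier ?E \<longrightarrow> v \<oplus>\<^bsub>?E\<^esub> w \<in> carrier ?E"
  proof (intro allI impI, elim conjE)
    fix v w assume "v \<in> carrier ?E" "w \<in> carrier ?E"
    moreover have "{m. v m \<oplus> w m \<noteq> \<zero>} \<subseteq> {m. v m \<noteq> \<zero>} \<union> {m. w m \<noteq> \<zero>}"
      by auto
    ultimately show "v \<oplus>\<^bsub>?E\<^esub> w \<in> carrier ?E"
      by (auto simp: mext_simps intro: finite_subset)
  qed
  show sm: "\<forall>c v. c \<in> carrier (class_ring :: complex ring) \<and> v \<in> carrier ?E \<longrightarrow>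
      c \<odot>\<^bsub>?E\<^esub> v \<in> carrier ?E"
  proof (intro allI impI, elim conjE)
    fix c v assume "v \<in> carrier ?E"
    moreover have "{m. c \<odot> v m \<noteq> \<zero>} \<subseteq> {m. v m \<noteq> \<zero>}"
      using rmult_0 by auto
    ultimately show "c \<odot>\<^bsub>?E\<^esub> v \<in> carrier ?E"
      by (auto simp: mext_simps intro: finite_subset)
  qed
  show "\<forall>v\<in>carrier ?E. \<exists>w\<in>carrier ?E. v \<oplus>\<^bsub>?E\<^esub> w = \<zero>\<^bsub>?E\<^esub>"
  proof
    fix v assume v: "v \<in> carrier ?E"
    have "v m \<oplus> (- 1) \<odot> v m = \<zero>" for m
      using v smult_minus_1[of "v m"] by (simp add: mext_simps class_ring_simps M.r_neg)
    then show "\<exists>w\<in>carrier ?E. v \<oplus>\<^bsub>?E\<^esub> w = \<zero>\<^bsub>?E\<^esub>"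
      using v sm by (intro bexI[of _ "(- 1) \<odot>\<^bsub>?E\<^esub> v"]) (simp_all add: mext_simps(2-4))
  qed
qed (auto simp: mext_simps M.add.m_ac smult_simps smult_r_distr fun_eq_iff)

text \<open>Enlarging the summation range adds only terms with a zero factor. Brackets with
  different arguments thus become sums over one common index set, where bilinearity can be checked
  term by term.\<close>

lemma bracket_mext_superset:
  assumes f: "f \<in> carrier (mext L)" and g: "g \<in> carrier (mext L)"
    and S: "finite S" "{(i, j). f i \<noteq> \<zero> \<and> g j \<noteq> \<zero> \<and> i + j = m} \<subseteq> S"
  shows "\<lbrakk>f, g\<rbrakk>\<^bsub>mext L\<^esub> m = (\<Oplus>p\<in>{p \<in> S. fst p + snd p = m}. \<lbrakk>f (fst p), g (snd p)\<rbrakk>\<^bsub>L\<^esub>)"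
  unfolding mext_simps(5)
proof (rule M.add.finprod_mono_neutral_cong_left)
  show "\<lbrakk>f (fst p), g (snd p)\<rbrakk>\<^bsub>L\<^esub> = \<zero>"
    if "p \<in> {p \<in> S. fst p + snd p = m} - {(i, j). f i \<noteq> \<zero> \<and> g j \<noteq> \<zero> \<and> i + j = m}" for p
  proof -
    have "f (fst p) = \<zero> \<or> g (snd p) = \<zero>"
      using that by (auto simp: case_prod_beta)
    then show "\<lbrakk>f (fst p), g (snd p)\<rbrakk>\<^bsub>L\<^esub> = \<zero>"
      using f g by (auto simp: mext_simps(1) bracket_zero_left bracket_zero_right)
  qed
qed (use assms in \<open>auto simp: mext_simps(1)\<close>)

lemma bracket_mext_closed:
  fixes f g :: "'m::comm_monoid_add \<Rightarrow> 'a"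
  assumes f: "f \<in> carrier (mext L)" and g: "g \<in> carrier (mext L)"
  shows "\<lbrakk>f, g\<rbrakk>\<^bsub>mext L\<^esub> \<in> carrier (mext L)"
proof -
  have "\<lbrakk>f, g\<rbrakk>\<^bsub>mext L\<^esub> m \<in> carrier L" for m
    using f g unfolding mext_simps(5) by (intro M.finsum_closed) (auto simp: mext_simps(1))
  \<comment> \<open>The support of a product lies in the sumset of the supports.\<close>
  moreover have "{m. \<lbrakk>f, g\<rbrakk>\<^bsub>mext L\<^esub> m \<noteq> \<zero>}
      \<subseteq> (\<lambda>(i, j). i + j) ` ({m. f m \<noteq> \<zero>} \<times> {m. g m \<noteq> \<zero>})"
  proof
    fix m assume m: "m \<in> {m. \<lbrakk>f, g\<rbrakk>\<^bsub>mext L\<^esub> m \<noteq> \<zero>}"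
    then have "{(i, j). f i \<noteq> \<zero> \<and> g j \<noteq> \<zero> \<and> i + j = m} \<noteq> {}"
      by (intro notI) (simp only: mext_simps(5) mem_Collect_eq M.finsum_empty simp_thms)
    then show "m \<in> (\<lambda>(i, j). i + j) ` ({m. f m \<noteq> \<zero>} \<times> {m. g m \<noteq> \<zero>})"
      by force
  qed
  ultimately show ?thesis
    unfolding mext_simps(1)
    using f g by (auto simp: mext_simps(1) intro: finite_subset)
qed

lemma bracket_mext_linear:
  fixes f g h :: "'m::comm_monoid_add \<Rightarrow> 'a"
  assumes f: "f \<in> carrier (mext L)" and g: "g \<in> carrier (mext L)" and h: "h \<in> carrier (mext L)"
  shows "\<lbrakk>f \<oplus>\<^bsub>mext L\<^esub> g, h\<rbrakk>\<^bsub>mext L\<^esub> = \<lbrakk>f, h\<rbrakk>\<^bsub>mext L\<^esub> \<oplus>\<^bsub>mext L\<^esub> \<lbrakk>g, h\<rbrakk>\<^bsub>mext L\<^esub>" (is ?add_left)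
    and "\<lbrakk>h, f \<oplus>\<^bsub>mext L\<^esub> g\<rbrakk>\<^bsub>mext L\<^esub> = \<lbrakk>h, f\<rbrakk>\<^bsub>mext L\<^esub> \<oplus>\<^bsub>mext L\<^esub> \<lbrakk>h, g\<rbrakk>\<^bsub>mext L\<^esub>" (is ?add_right)
    and "\<lbrakk>a \<odot>\<^bsub>mext L\<^esub> f, h\<rbrakk>\<^bsub>mext L\<^esub> = a \<odot>\<^bsub>mext L\<^esub> \<lbrakk>f, h\<rbrakk>\<^bsub>mext L\<^esub>" (is ?smult_left)
    and "\<lbrakk>h, a \<odot>\<^bsub>mext L\<^esub> f\<rbrakk>\<^bsub>mext L\<^esub> = a \<odot>\<^bsub>mext L\<^esub> \<lbrakk>h, f\<rbrakk>\<^bsub>mext L\<^esub>" (is ?smult_right)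
proof -
  interpret E: Module.module "class_ring :: complex ring" "mext L :: ('m \<Rightarrow> 'a) lie_alg"
    by (rule mext_module)
  \<comment> \<open>One index set for f and g that also contains the supports of their sum and of
    every multiple of f.\<close>
  define F where "F = {m. f m \<noteq> \<zero>} \<union> {m. g m \<noteq> \<zero>}"
  define H where "H = {m. h m \<noteq> \<zero>}"
  have fin: "finite (F \<times> H)" "finite (H \<times> F)"
    using f g h by (auto simp: F_def H_def mext_simps(1))
  have c: "f i \<in> carrier L" "g i \<in> carrier L" "h i \<in> carrier L" for i
    using f g h by (auto simp: mext_simps(1))
  have fg: "f \<oplus>\<^bsub>mext L\<^esub> g \<in> carrier (mext L)" "a \<odot>\<^bsub>mext L\<^esub> f \<in> carrier (mext L)"
    using f g by auto
  have supp: "f i \<oplus> g i \<noteq> \<zero> \<Longrightarrow> i \<in> F" "a \<odot> f i \<noteq> \<zero> \<Longrightarrow> i \<in> F" "f i \<noteq> \<zero> \<Longrightarrow> i \<in> F"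
    "g i \<noteq> \<zero> \<Longrightarrow> i \<in> F" "h i \<noteq> \<zero> \<Longrightarrow> i \<in> H" for i
    using rmult_0 by (auto simp: F_def H_def)
  note left = bracket_mext_superset[OF _ h fin(1)] and right = bracket_mext_superset[OF h _ fin(2)]
  show ?add_left
  proof
    fix m
    show "\<lbrakk>f \<oplus>\<^bsub>mext L\<^esub> g, h\<rbrakk>\<^bsub>mext L\<^esub> m = (\<lbrakk>f, h\<rbrakk>\<^bsub>mext L\<^esub> \<oplus>\<^bsub>mext L\<^esub> \<lbrakk>g, h\<rbrakk>\<^bsub>mext L\<^esub>) m"
      unfolding mext_simps(3)[of L "\<lbrakk>f, h\<rbrakk>\<^bsub>mext L\<^esub>"]
      by (subst (1 2 3) left)
        (use f g h fg supp c in \<open>auto simp: mext_simps(3) bracket_add_left M.finsum_addf\<close>)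
  qed
  show ?add_right
  proof
    fix m
    show "\<lbrakk>h, f \<oplus>\<^bsub>mext L\<^esub> g\<rbrakk>\<^bsub>mext L\<^esub> m = (\<lbrakk>h, f\<rbrakk>\<^bsub>mext L\<^esub> \<oplus>\<^bsub>mext L\<^esub> \<lbrakk>h, g\<rbrakk>\<^bsub>mext L\<^esub>) m"
      unfolding mext_simps(3)[of L "\<lbrakk>h, f\<rbrakk>\<^bsub>mext L\<^esub>"]
      by (subst (1 2 3) right)
        (use f g h fg supp c in \<open>auto simp: mext_simps(3) bracket_add_right M.finsum_addf\<close>)
  qed
  show ?smult_left
  proof
    fix m
    show "\<lbrakk>a \<odot>\<^bsub>mext L\<^esub> f, h\<rbrakk>\<^bsub>mext L\<^esub> m = (a \<odot>\<^bsub>mext L\<^esub> \<lbrakk>f, h\<rbrakk>\<^bsub>mext L\<^esub>) m"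
      unfolding mext_simps(4)[of L a "\<lbrakk>f, h\<rbrakk>\<^bsub>mext L\<^esub>"]
      by (subst (1 2) left)
        (use f h fg supp c fin in \<open>auto simp: mext_simps(4) bracket_smult_left finsum_smult_ldistr\<close>)
  qed
  show ?smult_right
  proof
    fix m
    show "\<lbrakk>h, a \<odot>\<^bsub>mext L\<^esub> f\<rbrakk>\<^bsub>mext L\<^esub> m = (a \<odot>\<^bsub>mext L\<^esub> \<lbrakk>h, f\<rbrakk>\<^bsub>mext L\<^esub>) m"
      unfolding mext_simps(4)[of L a "\<lbrakk>h, f\<rbrakk>\<^bsub>mext L\<^esub>"]
      by (subst (1 2) right)
        (use f h fg supp c fin in \<open>auto simp: mext_simps(4) bracket_smult_right finsum_smult_ldistr\<close>)
  qed
qed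

lemma bracket_mext_zero:
  fixes f :: "'m::comm_monoid_add \<Rightarrow> 'a"
  assumes f: "f \<in> carrier (mext L)"
  shows "\<lbrakk>\<zero>\<^bsub>mext L\<^esub>, f\<rbrakk>\<^bsub>mext L\<^esub> = \<zero>\<^bsub>mext L\<^esub>" "\<lbrakk>f, \<zero>\<^bsub>mext L\<^esub>\<rbrakk>\<^bsub>mext L\<^esub> = \<zero>\<^bsub>mext L\<^esub>"
proof -
  interpret E: Module.module "class_ring :: complex ring" "mext L :: ('m \<Rightarrow> 'a) lie_alg"
    by (rule mext_module)
  show "\<lbrakk>\<zero>\<^bsub>mext L\<^esub>, f\<rbrakk>\<^bsub>mext L\<^esub> = \<zero>\<^bsub>mext L\<^esub>" "\<lbrakk>f, \<zero>\<^bsub>mext L\<^esub>\<rbrakk>\<^bsub>mext L\<^esub> = \<zero>\<^bsub>mext L\<^esub>"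
    using f bracket_mext_linear(3)[of "\<zero>\<^bsub>mext L\<^esub>" "\<zero>\<^bsub>mext L\<^esub>" f 0]
      bracket_mext_linear(4)[of "\<zero>\<^bsub>mext L\<^esub>" "\<zero>\<^bsub>mext L\<^esub>" f 0] E.smult_l_null
    by (simp_all add: bracket_mext_closed)
qed

lemma monomial_closed: "x \<in> carrier L \<Longrightarrow> monomial L m x \<in> carrier (mext L)"
  by (auto simp: mext_simps(1) monomial_def)

lemma monomial_add: "x \<in> carrier L \<Longrightarrow> y \<in> carrier L \<Longrightarrow>
    monomial L m (x \<oplus> y) = monomial L m x \<oplus>\<^bsub>mext L\<^esub> monomial L m y"
  by (auto simp: mext_simps(3) monomial_def)

lemma monomial_smult: "x \<in> carrier L \<Longrightarrow> monomial L m (a \<odot> x) = a \<odot>\<^bsub>mext L\<^esub> monomial L m x"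
  by (auto simp: mext_simps(4) monomial_def rmult_0)

lemma monomial_zero: "monomial L m \<zero> = \<zero>\<^bsub>mext L\<^esub>"
  by (auto simp: mext_simps(2) monomial_def)

lemma bracket_monomial:
  assumes x: "x \<in> carrier L" and y: "y \<in> carrier L"
  shows "\<lbrakk>monomial L m x, monomial L n y\<rbrakk>\<^bsub>mext L\<^esub> = monomial L (m + n) \<lbrakk>x, y\<rbrakk>\<^bsub>L\<^esub>"
proof
  fix k
  \<comment> \<open>The range \<open>{(m, n)}\<close> also covers the case that x or y is zero,
    where the range in the definition is empty.\<close>
  have "{p \<in> {(m, n)}. fst p + snd p = k} = (if k = m + n then {(m, n)} else {})"
    by auto
  then show "\<lbrakk>monomial L m x, monomial L n y\<rbrakk>\<^bsub>mext L\<^esub> k = monomial L (m + n) \<lbrakk>x, y\<rbrakk>\<^bsub>L\<^esub> k"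
    using x y
    by (subst bracket_mext_superset[OF monomial_closed[OF x] monomial_closed[OF y],
          where S = "{(m, n)}"])
      (auto simp: monomial_def split: if_splits)
qed

text \<open>A finitely supported function is a finite sum of monomials; one index of the support is
  split off at a time. Scalars are absorbed into the coefficient of a monomial.\<close>

lemma mext_induct [consumes 1, case_names zero add monomial]:
  assumes f: "f \<in> carrier (mext L)"
    and zero: "P \<zero>\<^bsub>mext L\<^esub>"
    and add: "\<And>f g. f \<in> carrier (mext L) \<Longrightarrow> g \<in> carrier (mext L) \<Longrightarrow> P f \<Longrightarrow> P g \<Longrightarrow>
      P (f \<oplus>\<^bsub>mext L\<^esub> g)"
    and monomial: "\<And>m x. x \<in> carrier L \<Longrightarrow> P (monomial L m x)"
  shows "P f"
proof -
  have "\<forall>f\<in>carrier (mext L). {m. f m \<noteq> \<zero>} \<subseteq> S \<longrightarrow> P f" if "finite S" for S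
    using that
  proof (induction S rule: finite_induct)
    case empty
    have "f = \<zero>\<^bsub>mext L\<^esub>" if "{m. f m \<noteq> \<zero>} \<subseteq> {}" for f
      using that by (auto simp: mext_simps(2))
    with zero show ?case by blast
  next
    case (insert s S)
    show ?case
    proof (intro ballI impI)
      fix f assume f: "f \<in> carrier (mext L)" and sub: "{m. f m \<noteq> \<zero>} \<subseteq> insert s S"
      define h where "h = f(s := \<zero>)"
      have fs: "f s \<in> carrier L"
        using f by (simp add: mext_simps(1))
      have hS: "{m. h m \<noteq> \<zero>} \<subseteq> S"
        using sub by (auto simp: h_def)
      then have h: "h \<in> carrier (mext L)"
        using f insert.hyps by (auto simp: mext_simps(1) h_def intro: finite_subset)
      have "f = h \<oplus>\<^bsub>mext L\<^esub> monomial L s (f s)"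
        using f by (auto simp: mext_simps(1,3) h_def monomial_def)
      moreover have "P (h \<oplus>\<^bsub>mext L\<^esub> monomial L s (f s))"
        using insert.IH h hS monomial_closed[OF fs] monomial[OF fs] by (intro add) auto
      ultimately show "P f" by simp
    qed
  qed
  then show ?thesis
    using f by (auto simp: mext_simps(1))
qed

text \<open>The law \<open>[f, f] = 0\<close> is quadratic in f and does not pass to sums by itself.
  Skew symmetry is bilinear, hence can be reduced to monomials in each argument, and it gives the
  alternating law afterwards.\<close>

lemma mext_skew:
  fixes f g :: "'m::comm_monoid_add \<Rightarrow> 'a"
  assumes "f \<in> carrier (mext L)" "g \<in> carrier (mext L)"
  shows "\<lbrakk>f, g\<rbrakk>\<^bsub>mext L\<^esub> \<oplus>\<^bsub>mext L\<^esub> \<lbrakk>g, f\<rbrakk>\<^bsub>mext L\<^esub> = \<zero>\<^bsub>mext L\<^esub>"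
proof -
  interpret E: Module.module "class_ring :: complex ring" "mext L :: ('m \<Rightarrow> 'a) lie_alg"
    by (rule mext_module)
  note lin = bracket_mext_linear bracket_mext_closed and z = bracket_mext_zero
  \<comment> \<open>Regroups the four brackets of a sum into two cancelling pairs.\<close>
  have swap: "(a \<oplus>\<^bsub>mext L\<^esub> b) \<oplus>\<^bsub>mext L\<^esub> (c \<oplus>\<^bsub>mext L\<^esub> d) = (a \<oplus>\<^bsub>mext L\<^esub> c) \<oplus>\<^bsub>mext L\<^esub> (b \<oplus>\<^bsub>mext L\<^esub> d)"
    if "a \<in> carrier (mext L)" "b \<in> carrier (mext L)" "c \<in> carrier (mext L)" "d \<in> carrier (mext L)"
    for a b c d :: "'m \<Rightarrow> 'a"
    using that by (simp add: E.M.add.m_ac)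
  have mono: "\<lbrakk>monomial L m x, g\<rbrakk>\<^bsub>mext L\<^esub> \<oplus>\<^bsub>mext L\<^esub> \<lbrakk>g, monomial L m x\<rbrakk>\<^bsub>mext L\<^esub> = \<zero>\<^bsub>mext L\<^esub>"
    if x: "x \<in> carrier L" for m x
    using assms(2)
  proof (induction g rule: mext_induct)
    case (monomial n y)
    with x show ?case
      by (simp add: bracket_monomial add.commute[of n] bracket_skew monomial_zero flip: monomial_add)
  next
    case (add g h)
    then show ?case
      using x by (simp add: lin monomial_closed) (subst swap; simp add: lin monomial_closed)
  qed (use x in \<open>simp_all add: z monomial_closed\<close>)
  show ?thesis
    using assms(1)
  proof (induction f rule: mext_induct)
    case (add f h)
    then show ?case
      using assms(2) by (simp add: lin) (subst swap; simp add: lin)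
  qed (use assms(2) in \<open>simp_all add: z lin mono\<close>)
qed

text \<open>Division by 2, which turns skew symmetry into the alternating law.\<close>

lemma double_zero:
  assumes x: "x \<in> carrier L" and "x \<oplus> x = \<zero>"
  shows "x = \<zero>"
proof -
  have "x = (1 / 2 + 1 / 2 :: complex) \<odot> x"
    using smult_simps[OF x] by simp
  also have "\<dots> = (1 / 2) \<odot> (x \<oplus> x)"
    using x smult_l_distr[of "1 / 2" "1 / 2" x] smult_r_distr[of "1 / 2" x x] by simp
  also have "\<dots> = \<zero>"
    using assms(2) by (simp add: rmult_0)
  finally show ?thesis .
qed

text \<open>The Jacobi sum J is additive in each argument. It vanishes on three monomials by the
  Jacobi identity of L, and the arguments are then freed one at a time, from the last to the
  first.\<close>

lemma lie_algebra_mext: "lie_algebra (mext L :: ('m::comm_monoid_add \<Rightarrow> 'a) lie_alg)"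
proof -
  interpret E: Module.module "class_ring :: complex ring" "mext L :: ('m \<Rightarrow> 'a) lie_alg"
    by (rule mext_module)
  note lin = bracket_mext_linear bracket_mext_closed and z = bracket_mext_zero
  define J where "J f g h = \<lbrakk>f, \<lbrakk>g, h\<rbrakk>\<^bsub>mext L\<^esub>\<rbrakk>\<^bsub>mext L\<^esub> \<oplus>\<^bsub>mext L\<^esub> \<lbrakk>g, \<lbrakk>h, f\<rbrakk>\<^bsub>mext L\<^esub>\<rbrakk>\<^bsub>mext L\<^esub>
      \<oplus>\<^bsub>mext L\<^esub> \<lbrakk>h, \<lbrakk>f, g\<rbrakk>\<^bsub>mext L\<^esub>\<rbrakk>\<^bsub>mext L\<^esub>" for f g h :: "'m \<Rightarrow> 'a"
  have J_zero: "J \<zero>\<^bsub>mext L\<^esub> g h = \<zero>\<^bsub>mext L\<^esub>" "J g \<zero>\<^bsub>mext L\<^esub> h = \<zero>\<^bsub>mext L\<^esub>" "J g h \<zero>\<^bsub>mext L\<^esub> = \<zero>\<^bsub>mext L\<^esub>"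
    if "g \<in> carrier (mext L)" "h \<in> carrier (mext L)" for g h
    using that by (simp_all add: J_def z lin)
  have J_add: "J (f \<oplus>\<^bsub>mext L\<^esub> f') g h = J f g h \<oplus>\<^bsub>mext L\<^esub> J f' g h"
    "J g (f \<oplus>\<^bsub>mext L\<^esub> f') h = J g f h \<oplus>\<^bsub>mext L\<^esub> J g f' h"
    "J g h (f \<oplus>\<^bsub>mext L\<^esub> f') = J g h f \<oplus>\<^bsub>mext L\<^esub> J g h f'"
    if "f \<in> carrier (mext L)" "f' \<in> carrier (mext L)" "g \<in> carrier (mext L)" "h \<in> carrier (mext L)"
    for f f' g h
    using that by (simp_all add: J_def lin E.M.add.m_ac)
  have J3: "J (monomial L k x) (monomial L m y) h = \<zero>\<^bsub>mext L\<^esub>"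
    if xy: "x \<in> carrier L" "y \<in> carrier L" and h: "h \<in> carrier (mext L)" for x y k m h
    using h
  proof (induction h rule: mext_induct)
    case (monomial n w)
    \<comment> \<open>The three cyclic terms sit at the same exponent; they are brought to one form
      so that their coefficients can be added.\<close>
    have eq: "m + (n + k) = k + (m + n)" "n + (k + m) = k + (m + n)"
      by (simp_all add: ac_simps)
    show ?case
      using xy monomial
      by (simp add: J_def bracket_monomial eq jacobi monomial_zero flip: monomial_add)
  qed (use xy in \<open>simp_all add: J_zero J_add monomial_closed\<close>)
  have J2: "J (monomial L k x) g h = \<zero>\<^bsub>mext L\<^esub>"
    if x: "x \<in> carrier L" and g: "g \<in> carrier (mext L)" and h: "h \<in> carrier (mext L)" for x k g h
    using g
    by (induction g rule: mext_induct)
      (use x h in \<open>simp_all add: J_zero J_add J3 monomial_closed\<close>)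
  have J1: "J f g h = \<zero>\<^bsub>mext L\<^esub>"
    if f: "f \<in> carrier (mext L)" and g: "g \<in> carrier (mext L)" and h: "h \<in> carrier (mext L)" for f g h
    using f
    by (induction f rule: mext_induct)
      (use g h in \<open>simp_all add: J_zero J_add J2 monomial_closed\<close>)
  show ?thesis
  proof (intro lie_algebra.intro lie_algebra_axioms.intro vectorspace.intro mext_module class_field)
    fix f :: "'m \<Rightarrow> 'a" assume f: "f \<in> carrier (mext L)"
    show "\<lbrakk>f, f\<rbrakk>\<^bsub>mext L\<^esub> = \<zero>\<^bsub>mext L\<^esub>"
    proof
      fix m
      show "\<lbrakk>f, f\<rbrakk>\<^bsub>mext L\<^esub> m = \<zero>\<^bsub>mext L\<^esub> m"
        using fun_cong[OF mext_skew[OF f f], of m] bracket_mext_closed[OF f f]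
        by (simp only: mext_simps(1,2,3) double_zero)
    qed
  qed (use J1 in \<open>auto simp: lin J_def\<close>)
qed

text \<open>Because \<open>[x t^m, y t^0] = [x, y] t^m\<close>, perfectness of L yields every
  monomial. Placing the second factor at exponent 0 works in any monoid, inverses or not.\<close>

lemma perfect_mext:
  assumes "perfect_lie_algebra L"
  shows "perfect_lie_algebra (mext L :: ('m::comm_monoid_add \<Rightarrow> 'a) lie_alg)"
proof -
  let ?E = "mext L :: ('m \<Rightarrow> 'a) lie_alg"
  interpret E: lie_algebra ?E
    by (rule lie_algebra_mext)
  show ?thesis
  proof (rule E.perfectI, rule subsetI)
    fix N f
    assume N: "submodule (class_ring :: complex ring) N ?E"
      and brackets: "\<And>f g. f \<in> carrier ?E \<Longrightarrow> g \<in> carrier ?E \<Longrightarrow> \<lbrakk>f, g\<rbrakk>\<^bsub>?E\<^esub> \<in> N"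
      and f: "f \<in> carrier ?E"
    have mono: "x \<in> {x \<in> carrier L. monomial L m x \<in> N}" if x: "x \<in> carrier L" for m x
    proof (rule perfect_induct[OF assms _ _ x])
      show "submodule (class_ring :: complex ring) {x \<in> carrier L. monomial L m x \<in> N} L"
        using submodule.m_closed[OF N] submodule.zero_closed[OF N] submodule.smult_closed[OF N]
        by (intro submodule.intro self_module)
          (auto simp: monomial_add monomial_smult monomial_zero)
      fix x y assume "x \<in> carrier L" "y \<in> carrier L"
      then show "\<lbrakk>x, y\<rbrakk>\<^bsub>L\<^esub> \<in> {x \<in> carrier L. monomial L m x \<in> N}"
        using brackets[of "monomial L m x" "monomial L 0 y"]
        by (simp add: monomial_closed bracket_monomial)
    qed
    show "f \<in> N"
      using f
      by (induction f rule: mext_induct)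
        (use mono submodule.m_closed[OF N] submodule.zero_closed[OF N] in auto)
  qed
qed

end

section \<open>Universal central extensions of perfect central extensions\<close>

lemma lie_hom_mod_hom:
  assumes "lie_algebra L" "lie_algebra M" "\<phi> \<in> lie_hom L M"
  shows "mod_hom (class_ring :: complex ring) L M \<phi>"
  using lie_algebra.self_module[OF assms(1)] lie_algebra.self_module[OF assms(2)] assms(3)
  by (intro mod_hom.intro mod_hom_axioms.intro) (simp_all add: lie_hom_def)

lemma lie_hom_comp:
  assumes "\<phi> \<in> lie_hom L M" "\<psi> \<in> lie_hom M K"
  shows "(\<lambda>x. \<psi> (\<phi> x)) \<in> lie_hom L K"
  using lie_homD[OF assms(1)] lie_homD[OF assms(2)]
  by (auto simp: lie_hom_def LinearCombinations.module_hom_def Pi_iff)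

text \<open>Stated through submodules, as in \<open>perfect_induct\<close>, so that it is applied by
  showing that the solution set of a property is a submodule.\<close>

definition spanning :: "'a lie_alg \<Rightarrow> 'a set \<Rightarrow> bool" where
  "spanning L G \<longleftrightarrow> G \<subseteq> carrier L \<and>
     (\<forall>N. submodule (class_ring :: complex ring) N L \<longrightarrow> G \<subseteq> N \<longrightarrow> carrier L \<subseteq> N)"

lemma spanningD:
  assumes "spanning L G" "submodule (class_ring :: complex ring) N L" "\<And>x. x \<in> G \<Longrightarrow> x \<in> N"
    "x \<in> carrier L"
  shows "x \<in> N"
  using assms unfolding spanning_def by blast

lemma spanning_carrier: "spanning L (carrier L)"
  by (simp add: spanning_def)

text \<open>The equalizer of two linear maps is a submodule.\<close>

lemma module_hom_eqI:
  assumes "spanning L G" "mod_hom (class_ring :: complex ring) L M \<phi>"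
    "mod_hom (class_ring :: complex ring) L M \<psi>"
    and eq: "\<And>x. x \<in> G \<Longrightarrow> \<phi> x = \<psi> x" and x: "x \<in> carrier L"
  shows "\<phi> x = \<psi> x"
proof -
  interpret \<phi>: mod_hom "class_ring :: complex ring" L M \<phi> by fact
  interpret \<psi>: mod_hom "class_ring :: complex ring" L M \<psi> by fact
  have "x \<in> {x \<in> carrier L. \<phi> x = \<psi> x}"
  proof (rule spanningD[OF assms(1) _ _ x])
    show "submodule (class_ring :: complex ring) {x \<in> carrier L. \<phi> x = \<psi> x} L"
      by (intro submodule.intro \<phi>.M.module_axioms) auto
  qed (use assms(1) eq in \<open>auto simp: spanning_def\<close>)
  then show ?thesis by simp
qed

text \<open>Both sides are bilinear, so the identity extends from G to the carrier in one argument
  at a time.\<close>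

lemma lie_hom_spanningI:
  assumes L: "lie_algebra L" and M: "lie_algebra M" and G: "spanning L G"
    and \<phi>: "\<phi> \<in> LinearCombinations.module_hom class_ring L M"
    and bracket: "\<And>x y. x \<in> G \<Longrightarrow> y \<in> G \<Longrightarrow> \<phi> \<lbrakk>x, y\<rbrakk>\<^bsub>L\<^esub> = \<lbrakk>\<phi> x, \<phi> y\<rbrakk>\<^bsub>M\<^esub>"
  shows "\<phi> \<in> lie_hom L M"
proof -
  interpret L: lie_algebra L by (rule L)
  interpret M: lie_algebra M by (rule M)
  interpret \<phi>: mod_hom "class_ring :: complex ring" L M \<phi>
    using L.self_module M.self_module \<phi> by (intro mod_hom.intro mod_hom_axioms.intro)
  have GL: "x \<in> carrier L" if "x \<in> G" for x
    using G that by (auto simp: spanning_def)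
  have s: "\<phi> (a \<odot>\<^bsub>L\<^esub> x) = a \<odot>\<^bsub>M\<^esub> \<phi> x" if "x \<in> carrier L" for a x
    using \<phi>.f_smult[of a x] that by simp
  have sc: "a \<odot>\<^bsub>L\<^esub> x \<in> carrier L" if "x \<in> carrier L" for a x
    using that by auto
  have *: "y \<in> {y \<in> carrier L. \<phi> \<lbrakk>x, y\<rbrakk>\<^bsub>L\<^esub> = \<lbrakk>\<phi> x, \<phi> y\<rbrakk>\<^bsub>M\<^esub>}"
    if x: "x \<in> G" and y: "y \<in> carrier L" for x y
  proof (rule spanningD[OF G _ _ y])
    show "submodule (class_ring :: complex ring)
        {y \<in> carrier L. \<phi> \<lbrakk>x, y\<rbrakk>\<^bsub>L\<^esub> = \<lbrakk>\<phi> x, \<phi> y\<rbrakk>\<^bsub>M\<^esub>} L"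
      using GL[OF x]
      by (intro submodule.intro L.self_module)
        (auto simp: L.bracket_add_right M.bracket_add_right L.bracket_smult_right
          M.bracket_smult_right L.bracket_zero_right M.bracket_zero_right s sc)
  qed (use bracket x GL in auto)
  have "x \<in> {x \<in> carrier L. \<phi> \<lbrakk>x, y\<rbrakk>\<^bsub>L\<^esub> = \<lbrakk>\<phi> x, \<phi> y\<rbrakk>\<^bsub>M\<^esub>}"
    if y: "y \<in> carrier L" and x: "x \<in> carrier L" for x y
  proof (rule spanningD[OF G _ _ x])
    show "submodule (class_ring :: complex ring)
        {x \<in> carrier L. \<phi> \<lbrakk>x, y\<rbrakk>\<^bsub>L\<^esub> = \<lbrakk>\<phi> x, \<phi> y\<rbrakk>\<^bsub>M\<^esub>} L"
      using y
      by (intro submodule.intro L.self_module)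
        (auto simp: L.bracket_add_left M.bracket_add_left L.bracket_smult_left
          M.bracket_smult_left L.bracket_zero_left M.bracket_zero_left s sc)
  qed (use * y GL in auto)
  then show ?thesis
    using \<phi> by (simp add: lie_hom_def)
qed

section \<open>Extension of scalars for homomorphisms and central extensions\<close>

lemma (in lie_algebra) spanning_mext:
  assumes "spanning L G"
  shows "spanning (mext L :: ('m::comm_monoid_add \<Rightarrow> 'a) lie_alg) {monomial L m x | m x. x \<in> G}"
  unfolding spanning_def
proof (intro conjI allI impI subsetI)
  fix f :: "'m \<Rightarrow> 'a" assume "f \<in> {monomial L m x | m x. x \<in> G}"
  then show "f \<in> carrier (mext L)"
    using assms by (auto simp: spanning_def intro!: monomial_closed)
next
  fix N :: "('m \<Rightarrow> 'a) set" and f :: "'m \<Rightarrow> 'a"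
  assume N: "submodule (class_ring :: complex ring) N (mext L)"
    and G: "{monomial L m x | m x. x \<in> G} \<subseteq> N" and f: "f \<in> carrier (mext L)"
  \<comment> \<open>For a fixed exponent, the coefficients whose monomial lies in N form a submodule
    of L containing G.\<close>
  have mono: "x \<in> {x \<in> carrier L. monomial L m x \<in> N}" if x: "x \<in> carrier L" for m x
  proof (rule spanningD[OF assms _ _ x])
    show "submodule (class_ring :: complex ring) {x \<in> carrier L. monomial L m x \<in> N} L"
      using submodule.m_closed[OF N] submodule.zero_closed[OF N] submodule.smult_closed[OF N]
      by (intro submodule.intro self_module)
        (auto simp: monomial_add monomial_smult monomial_zero)
  qed (use assms G in \<open>auto simp: spanning_def\<close>)
  show "f \<in> N"
    using f
    by (induction f rule: mext_induct)
      (use mono submodule.m_closed[OF N] submodule.zero_closed[OF N] in auto)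
qed

text \<open>On monomials the map is \<open>\<theta>\<close> on coefficients, so compatibility with
  the bracket reduces to that of \<open>\<theta>\<close>.\<close>

lemma lie_hom_mext:
  assumes A: "lie_algebra A" and B: "lie_algebra B" and \<theta>: "\<theta> \<in> lie_hom A B"
  shows "(\<lambda>f m. \<theta> (f m)) \<in> lie_hom (mext A) (mext B :: ('m::comm_monoid_add \<Rightarrow> 'b) lie_alg)"
proof -
  interpret A: lie_algebra A by (rule A)
  interpret B: lie_algebra B by (rule B)
  interpret \<theta>: mod_hom "class_ring :: complex ring" A B \<theta>
    by (rule lie_hom_mod_hom[OF A B \<theta>])
  note hom = lie_homD[OF \<theta>]
  have closed: "(\<lambda>m. \<theta> (f m)) \<in> carrier (mext B)" if "f \<in> carrier (mext A)" for f :: "'m \<Rightarrow> _"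
  proof -
    have "{m. \<theta> (f m) \<noteq> \<zero>\<^bsub>B\<^esub>} \<subseteq> {m. f m \<noteq> \<zero>\<^bsub>A\<^esub>}"
      by auto
    then show ?thesis
      using that by (auto simp: mext_simps(1) hom intro: finite_subset)
  qed
  have mono: "(\<lambda>n. \<theta> (monomial A m x n)) = monomial B m (\<theta> x)" for m :: 'm and x
    by (auto simp: monomial_def)
  show ?thesis
  proof (rule lie_hom_spanningI[OF A.lie_algebra_mext B.lie_algebra_mext
        A.spanning_mext[OF spanning_carrier]])
    show "(\<lambda>f m. \<theta> (f m)) \<in> LinearCombinations.module_hom class_ring (mext A)
        (mext B :: ('m \<Rightarrow> 'b) lie_alg)"
      using closed by (auto simp: LinearCombinations.module_hom_def mext_simps(1,3,4) hom)
  qed (auto simp: A.bracket_monomial B.bracket_monomial mono hom)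
qed

text \<open>The passage from \<open>(L[t_1])[t_2]\<close> to \<open>L[t_1, t_2]\<close>. The inner
  extension carries the first variable, hence the exchanged order of i and j. On monomials both
  brackets add the pairs of exponents.\<close>

lemma lie_hom_uncurry:
  assumes L: "lie_algebra L"
  shows "(\<lambda>F (i, j). F j i) \<in> lie_hom (mext (mext L :: ('m::comm_monoid_add \<Rightarrow> 'a) lie_alg))
      (mext L :: ('m \<times> 'n::comm_monoid_add \<Rightarrow> 'a) lie_alg)" (is "?h \<in> _")
proof -
  interpret L: lie_algebra L by (rule L)
  interpret E: lie_algebra "mext L :: ('m \<Rightarrow> 'a) lie_alg" by (rule L.lie_algebra_mext)
  have closed: "?h F \<in> carrier (mext L)"
    if F: "F \<in> carrier (mext (mext L))" for F :: "'n \<Rightarrow> 'm \<Rightarrow> 'a"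
  proof -
    \<comment> \<open>Finitely many nonzero layers, each with finite support.\<close>
    have "{p. ?h F p \<noteq> \<zero>\<^bsub>L\<^esub>}
        \<subseteq> (\<Union>j\<in>{j. F j \<noteq> \<zero>\<^bsub>mext L\<^esub>}. {i. F j i \<noteq> \<zero>\<^bsub>L\<^esub>} \<times> {j})"
      by (auto simp: mext_simps(2))
    moreover have "finite (\<Union>j\<in>{j. F j \<noteq> \<zero>\<^bsub>mext L\<^esub>}. {i. F j i \<noteq> \<zero>\<^bsub>L\<^esub>} \<times> {j})"
      using F by (auto simp: mext_simps(1))
    ultimately have "finite {p. ?h F p \<noteq> \<zero>\<^bsub>L\<^esub>}"
      by (rule finite_subset)
    then show ?thesis
      using F unfolding mext_simps(1) by auto
  qed
  have mono: "?h (monomial (mext L) j (monomial L i x)) = monomial L (i, j) x"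
    for x and j :: 'n and i :: 'm
    by (auto simp: monomial_def fun_eq_iff mext_simps(2))
  show ?thesis
  proof (rule lie_hom_spanningI[OF E.lie_algebra_mext L.lie_algebra_mext
        E.spanning_mext[OF L.spanning_mext[OF spanning_carrier]]])
    show "?h \<in> LinearCombinations.module_hom class_ring
        (mext (mext L :: ('m \<Rightarrow> 'a) lie_alg)) (mext L)"
      using closed by (auto simp: LinearCombinations.module_hom_def mext_simps(3,4) fun_eq_iff)
  qed (auto simp: E.bracket_monomial L.bracket_monomial L.monomial_closed mono)
qed

text \<open>The projection applies \<open>\<theta>\<close> to each coefficient and then merges the
  two variables, so surjectivity and centrality both descend to coefficients.\<close>

lemma central_extension_mext:
  assumes ext: "central_extension A \<theta> (mext L :: ('m::comm_monoid_add \<Rightarrow> 'a) lie_alg)"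
    and L: "lie_algebra L"
  shows "central_extension (mext A) (\<lambda>F (i, j). \<theta> (F j) i)
      (mext L :: ('m \<times> 'n::comm_monoid_add \<Rightarrow> 'a) lie_alg)" (is "central_extension ?E ?\<pi> ?L")
proof -
  interpret L: lie_algebra L by (rule L)
  interpret A: lie_algebra A
    using ext by (simp add: central_extension_def)
  have \<theta>: "\<theta> \<in> lie_hom A (mext L)" and surj: "\<theta> ` carrier A = carrier (mext L)"
    and ker: "\<And>z x. z \<in> carrier A \<Longrightarrow> \<theta> z = \<zero>\<^bsub>mext L\<^esub> \<Longrightarrow> x \<in> carrier A \<Longrightarrow> \<lbrakk>z, x\<rbrakk>\<^bsub>A\<^esub> = \<zero>\<^bsub>A\<^esub>"
    using ext unfolding central_extension_def by blast+
  have \<theta>0: "\<theta> \<zero>\<^bsub>A\<^esub> = \<zero>\<^bsub>mext L\<^esub>"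
    using mod_hom.f0_is_0[OF lie_hom_mod_hom[OF A.lie_algebra_axioms L.lie_algebra_mext \<theta>]] .
  have hom: "?\<pi> \<in> lie_hom ?E ?L"
    using lie_hom_comp[OF lie_hom_mext[OF A.lie_algebra_axioms L.lie_algebra_mext \<theta>]
        lie_hom_uncurry[OF L]] .
  show ?thesis
    unfolding central_extension_def
  proof (intro conjI ballI impI A.lie_algebra_mext L.lie_algebra_mext hom)
    interpret \<pi>: mod_hom "class_ring :: complex ring" ?E ?L ?\<pi>
      by (rule lie_hom_mod_hom[OF A.lie_algebra_mext L.lie_algebra_mext hom])
    \<comment> \<open>The image is a submodule, so monomials suffice; a preimage of
      \<open>x t_1^i\<close> placed at exponent j maps to \<open>x t_1^i t_2^j\<close>.\<close>
    have "h \<in> \<pi>.im" if "h \<in> carrier ?L" for h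
    proof (rule spanningD[OF L.spanning_mext[OF spanning_carrier] \<pi>.im_is_submodule _ that])
      fix h :: "'m \<times> 'n \<Rightarrow> 'a"
      assume "h \<in> {monomial L m x | m x. x \<in> carrier L}"
      then obtain i j x where x: "x \<in> carrier L" and h: "h = monomial L (i, j) x"
        by auto
      obtain e where e: "e \<in> carrier A" "\<theta> e = monomial L i x"
        using surj L.monomial_closed[OF x, of i] by (metis imageE)
      have "?\<pi> (monomial A j e) = h"
        using e(2) \<theta>0 by (auto simp: h monomial_def fun_eq_iff mext_simps(2))
      then show "h \<in> \<pi>.im"
        unfolding \<pi>.im_def using A.monomial_closed[OF e(1), of j] by (intro image_eqI) simp_all
    qed
    then show "?\<pi> ` carrier ?E = carrier ?L"
      using lie_homD(1)[OF hom] unfolding \<pi>.im_def by blast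
  next
    fix F G :: "'n \<Rightarrow> _"
    assume F: "F \<in> carrier ?E" and F0: "?\<pi> F = \<zero>\<^bsub>?L\<^esub>" and G: "G \<in> carrier ?E"
    \<comment> \<open>Each coefficient of F lies in the kernel of \<open>\<theta>\<close>, so every
      term of the convolution vanishes.\<close>
    have "\<theta> (F j) = \<zero>\<^bsub>mext L\<^esub>" for j
      using F0 by (auto simp: mext_simps(2) fun_eq_iff)
    then have "\<lbrakk>F i, G j\<rbrakk>\<^bsub>A\<^esub> = \<zero>\<^bsub>A\<^esub>" for i j
      using F G by (intro ker) (auto simp: mext_simps(1))
    then show "\<lbrakk>F, G\<rbrakk>\<^bsub>?E\<^esub> = \<zero>\<^bsub>?E\<^esub>"
      by (simp add: mext_simps(2,5))
  qed
qed

section \<open>Linear maps out of the universal central extension\<close>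

context lie_algebra
begin

text \<open>The linear universal property of the presentation by symbols. In contrast to
  \<open>uce_lift\<close>, the target M may be any module, without a projection onto L.\<close>

lemma uce_hom_of_pairing:
  fixes M :: "'e lie_alg"
  assumes M: "Module.module (class_ring :: complex ring) M"
    and closed: "\<And>x y. x \<in> carrier L \<Longrightarrow> y \<in> carrier L \<Longrightarrow> g x y \<in> carrier M"
    and props: "\<And>x y z. x \<in> carrier L \<Longrightarrow> y \<in> carrier L \<Longrightarrow> z \<in> carrier L \<Longrightarrow>
        g (x \<oplus> y) z = g x z \<oplus>\<^bsub>M\<^esub> g y z"
      "\<And>x y z. x \<in> carrier L \<Longrightarrow> y \<in> carrier L \<Longrightarrow> z \<in> carrier L \<Longrightarrow>
        g x (y \<oplus> z) = g x y \<oplus>\<^bsub>M\<^esub> g x z"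
      "\<And>a x y. x \<in> carrier L \<Longrightarrow> y \<in> carrier L \<Longrightarrow> g (a \<odot> x) y = a \<odot>\<^bsub>M\<^esub> g x y"
      "\<And>a x y. x \<in> carrier L \<Longrightarrow> y \<in> carrier L \<Longrightarrow> g x (a \<odot> y) = a \<odot>\<^bsub>M\<^esub> g x y"
      "\<And>x. x \<in> carrier L \<Longrightarrow> g x x = \<zero>\<^bsub>M\<^esub>"
      "\<And>x y z. x \<in> carrier L \<Longrightarrow> y \<in> carrier L \<Longrightarrow> z \<in> carrier L \<Longrightarrow>
        g x \<lbrakk>y, z\<rbrakk>\<^bsub>L\<^esub> \<oplus>\<^bsub>M\<^esub> g y \<lbrakk>z, x\<rbrakk>\<^bsub>L\<^esub> \<oplus>\<^bsub>M\<^esub> g z \<lbrakk>x, y\<rbrakk>\<^bsub>L\<^esub> = \<zero>\<^bsub>M\<^esub>"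
  obtains f where "f \<in> LinearCombinations.module_hom class_ring (uce L) M"
    and "\<And>x y. x \<in> carrier L \<Longrightarrow> y \<in> carrier L \<Longrightarrow> f (pair x y) = g x y"
proof -
  define f where "f = lin_ext M (\<lambda>p. g (fst p) (snd p))"
  have f_hom: "f \<in> LinearCombinations.module_hom class_ring (symb_space L) M"
    unfolding f_def by (rule lin_ext_hom[OF M]) (auto simp: closed)
  have f_symb: "f (symb x y) = g x y" if "x \<in> carrier L" "y \<in> carrier L" for x y
    unfolding f_def using that by (subst lin_ext_symb[OF M]) (auto simp: closed)
  note kills = hom_kills_relations[OF M f_hom f_symb props]
  define \<phi> where "\<phi> X = the_elem (f ` X)" for X
  have \<phi>_coset: "\<phi> (coset c) = f c" if "c \<in> carrier (symb_space L)" for c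
    unfolding \<phi>_def by (rule the_elem_hom_coset[OF M f_hom kills that])
  note hom = f_hom[unfolded LinearCombinations.module_hom_def symb_space_simps(3,4)]
  have mult: "(\<lambda>p. b * c p) \<in> carrier (symb_space L)" if "c \<in> carrier (symb_space L)" for b c
    using symb_space_add_closed[OF that that, of b 0] by simp
  note sum = symb_space_add_closed[of _ L _ 1 1, simplified]
  have "\<phi> \<in> LinearCombinations.module_hom class_ring (uce L) M"
    unfolding LinearCombinations.module_hom_def
    using hom
    by (auto simp: carrier_uce add_uce smult_uce \<phi>_coset sum mult Pi_iff)
  moreover have "\<phi> (pair x y) = g x y" if "x \<in> carrier L" "y \<in> carrier L" for x y
    using that by (simp add: pair_def \<phi>_coset symb_in_symb_space f_symb)
  ultimately show thesis
    by (rule that)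
qed

text \<open>The preimage of N under the quotient map is a submodule of the formal combinations that
  contains all symbols, hence everything.\<close>

lemma spanning_uce: "spanning (uce L) {pair x y | x y. x \<in> carrier L \<and> y \<in> carrier L}"
  unfolding spanning_def
proof (intro conjI allI impI subsetI)
  fix N X assume N: "submodule (class_ring :: complex ring) N (uce L)"
    and pairs: "{pair x y | x y. x \<in> carrier L \<and> y \<in> carrier L} \<subseteq> N"
    and X: "X \<in> carrier (uce L)"
  obtain c where c: "c \<in> carrier (symb_space L)" "X = coset c"
    using X by (rule uceE)
  have mult: "(\<lambda>p. b * c p) \<in> carrier (symb_space L)" if "c \<in> carrier (symb_space L)" for b c
    using symb_space_add_closed[OF that that, of b 0] by simp
  note sum = symb_space_add_closed[of _ L _ 1 1, simplified]
  have "c \<in> {c \<in> carrier (symb_space L). coset c \<in> N}" (is "_ \<in> ?K")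
  proof (rule symb_space_eqI[OF _ _ c(1)])
    show "submodule class_ring ?K (symb_space L)"
    proof (rule submodule.intro)
      show "\<zero>\<^bsub>symb_space L\<^esub> \<in> ?K"
        using submodule.zero_closed[OF N] by (simp add: symb_space_simps(1,2) zero_uce)
      show "v \<oplus>\<^bsub>symb_space L\<^esub> w \<in> ?K" if "v \<in> ?K" "w \<in> ?K" for v w
        using that submodule.m_closed[OF N, of "coset v" "coset w"]
        by (simp add: symb_space_simps(3) add_uce sum)
      show "a \<odot>\<^bsub>symb_space L\<^esub> v \<in> ?K" if "v \<in> ?K" for a v
        using that submodule.smult_closed[OF N, of a "coset v"]
        by (simp add: symb_space_simps(4) smult_uce mult)
    qed (auto intro: symb_space_module)
    fix x y assume "x \<in> carrier L" "y \<in> carrier L"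
    then show "symb x y \<in> ?K"
      using pairs by (auto simp: symb_in_symb_space pair_def)
  qed
  with c show "X \<in> N" by simp
qed (auto intro: pair_closed)

end

text \<open>The isomorphism \<open>\<phi>\<close> is a lift of \<open>uce L\<close> along the
  composite of \<open>uce E\<close>, E and L. Its inverse \<open>\<psi>\<close> sends
  \<open>\<langle>x, y\<rangle>\<close> to \<open>\<langle>\<pi> x, \<pi> y\<rangle>\<close>, and
  both composites are compared with the identity on symbols.\<close>

theorem uce_central_extension_iso:
  assumes ext: "central_extension E \<pi> L"
    and E: "perfect_lie_algebra E" and L: "perfect_lie_algebra L"
  shows "uce L \<cong>\<^sub>L uce E"
proof -
  interpret E: lie_algebra E
    using E by (simp add: perfect_lie_algebra_def)
  interpret L: lie_algebra L
    using L by (simp add: perfect_lie_algebra_def)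
  interpret UE: lie_algebra "uce E" by (rule E.lie_algebra_uce)
  interpret UL: lie_algebra "uce L" by (rule L.lie_algebra_uce)
  have \<pi>: "\<pi> \<in> lie_hom E L" and surj: "\<pi> ` carrier E = carrier L"
    and central: "\<And>z x. z \<in> carrier E \<Longrightarrow> \<pi> z = \<zero>\<^bsub>L\<^esub> \<Longrightarrow> x \<in> carrier E \<Longrightarrow> \<lbrakk>z, x\<rbrakk>\<^bsub>E\<^esub> = \<zero>\<^bsub>E\<^esub>"
    using ext unfolding central_extension_def by blast+
  note hom = lie_homD[OF \<pi>]
  have projE: "uce_proj E \<in> lie_hom (uce E) E"
    by (simp add: lie_hom_def E.uce_proj_hom_module E.uce_proj_bracket)
  have pair_zero: "E.pair x \<zero>\<^bsub>E\<^esub> = \<zero>\<^bsub>uce E\<^esub>" if "x \<in> carrier E" for x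
    using E.pair_smult_right[of x "\<zero>\<^bsub>E\<^esub>" x 0] that
      UE.smult_simps(2)[OF E.pair_closed[of x "\<zero>\<^bsub>E\<^esub>"]] E.smult_simps(2) by simp
  have pair_central: "E.pair z x = \<zero>\<^bsub>uce E\<^esub>"
    if z: "z \<in> carrier E" "\<pi> z = \<zero>\<^bsub>L\<^esub>" and x: "x \<in> carrier E" for z x
  proof -
    have "x \<in> {x \<in> carrier E. E.pair z x = \<zero>\<^bsub>uce E\<^esub>}"
    proof (rule E.perfect_induct[OF E _ _ x])
      show "submodule (class_ring :: complex ring) {x \<in> carrier E. E.pair z x = \<zero>\<^bsub>uce E\<^esub>} E"
        using z pair_zero[OF z(1)] E.pair_add_right[OF z(1)] E.pair_smult_right[OF z(1) _ z(1)]
        by (intro submodule.intro E.self_module) (auto simp: UE.rmult_0)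
      fix a b assume a: "a \<in> carrier E" and b: "b \<in> carrier E"
      have "\<lbrakk>z, a\<rbrakk>\<^bsub>E\<^esub> = \<zero>\<^bsub>E\<^esub>" "\<lbrakk>b, z\<rbrakk>\<^bsub>E\<^esub> = \<zero>\<^bsub>E\<^esub>"
        using central[OF z a] central[OF z b] E.bracket_skew[OF b z(1)] b z(1) by simp_all
      then show "\<lbrakk>a, b\<rbrakk>\<^bsub>E\<^esub> \<in> {x \<in> carrier E. E.pair z x = \<zero>\<^bsub>uce E\<^esub>}"
        using E.pair_cyclic[OF z(1) a b] a b z(1) by (simp add: pair_zero E.pair_closed)
    qed
    then show ?thesis by simp
  qed
  \<comment> \<open>An element over zero projects into the kernel of \<open>\<pi>\<close>, so its
    brackets are symbols \<open>E.pair z x\<close> with z in that kernel;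
    \<open>pair_central\<close> is thus exactly the centrality of the composite.\<close>
  have extU: "central_extension (uce E) (\<lambda>X. \<pi> (uce_proj E X)) L"
    unfolding central_extension_def
  proof (intro conjI ballI impI UE.lie_algebra_axioms L.lie_algebra_axioms)
    show "(\<lambda>X. \<pi> (uce_proj E X)) \<in> lie_hom (uce E) L"
      by (rule lie_hom_comp[OF projE \<pi>])
    show "(\<lambda>X. \<pi> (uce_proj E X)) ` carrier (uce E) = carrier L"
      unfolding surj[symmetric] E.uce_proj_surj[OF E, symmetric] by (rule image_image[symmetric])
  qed (simp add: E.bracket_uce E.uce_proj_closed pair_central)
  obtain \<phi> where \<phi>: "\<phi> \<in> lie_hom (uce L) (uce E)"
    and \<pi>\<phi>: "\<And>X. X \<in> carrier (uce L) \<Longrightarrow> \<pi> (uce_proj E (\<phi> X)) = uce_proj L X"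
    using L.uce_lift[OF extU] by blast
  note \<phi>_hom = lie_homD[OF \<phi>]
  \<comment> \<open>Linearity is enough here: \<open>\<phi>\<close> carries the bracket, and
    \<open>\<psi>\<close> serves as its two-sided inverse.\<close>
  obtain \<psi> where \<psi>: "\<psi> \<in> LinearCombinations.module_hom class_ring (uce E) (uce L)"
    and \<psi>_pair: "\<And>x y. x \<in> carrier E \<Longrightarrow> y \<in> carrier E \<Longrightarrow> \<psi> (E.pair x y) = L.pair (\<pi> x) (\<pi> y)"
  proof (rule E.uce_hom_of_pairing[OF L.uce_module, of "\<lambda>x y. L.pair (\<pi> x) (\<pi> y)"])
    fix x y and a :: complex assume x: "x \<in> carrier E" and y: "y \<in> carrier E"
    note p = L.pair_props[OF hom(1)[OF x] hom(1)[OF y] hom(1)[OF x]]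
    show "L.pair (\<pi> (a \<odot>\<^bsub>E\<^esub> x)) (\<pi> y) = a \<odot>\<^bsub>uce L\<^esub> L.pair (\<pi> x) (\<pi> y)"
      "L.pair (\<pi> x) (\<pi> (a \<odot>\<^bsub>E\<^esub> y)) = a \<odot>\<^bsub>uce L\<^esub> L.pair (\<pi> x) (\<pi> y)"
      using p x y by (simp_all add: hom)
  next
    show "L.pair (\<pi> x) (\<pi> x) = \<zero>\<^bsub>uce L\<^esub>" if "x \<in> carrier E" for x
      using hom(1)[OF that] by (intro L.pair_self)
  qed (simp_all add: L.pair_closed L.pair_add_left L.pair_add_right L.pair_cyclic hom)
  have \<phi>_mod: "mod_hom (class_ring :: complex ring) (uce L) (uce E) \<phi>"
    by (rule lie_hom_mod_hom[OF UL.lie_algebra_axioms UE.lie_algebra_axioms \<phi>])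
  have comp_mod: "mod_hom (class_ring :: complex ring) K K (\<lambda>X. g (f X))"
    if "f \<in> LinearCombinations.module_hom class_ring K M"
      "g \<in> LinearCombinations.module_hom class_ring M K"
      "Module.module (class_ring :: complex ring) K"
    for f :: "'k \<Rightarrow> 'm" and g K M
    using that by (intro mod_hom.intro mod_hom_axioms.intro)
      (auto simp: LinearCombinations.module_hom_def Pi_iff)
  have id_mod: "mod_hom (class_ring :: complex ring) K K (\<lambda>X. X)"
    if "Module.module (class_ring :: complex ring) K" for K :: "'k lie_alg"
    using that by (intro mod_hom.intro mod_hom_axioms.intro)
      (auto simp: LinearCombinations.module_hom_def)
  have \<phi>': "\<phi> \<in> LinearCombinations.module_hom class_ring (uce L) (uce E)"
    using \<phi> by (simp add: lie_hom_def)
  have surjL: "\<exists>A\<in>carrier (uce L). uce_proj L A = x" if "x \<in> carrier L" for x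
  proof -
    have "x \<in> uce_proj L ` carrier (uce L)"
      using that by (simp only: L.uce_proj_surj[OF L])
    then show ?thesis by blast
  qed
  have surjE: "\<exists>A\<in>carrier (uce E). uce_proj E A = x" if "x \<in> carrier E" for x
  proof -
    have "x \<in> uce_proj E ` carrier (uce E)"
      using that by (simp only: E.uce_proj_surj[OF E])
    then show ?thesis by blast
  qed
  \<comment> \<open>Every symbol is a bracket in \<open>uce L\<close>, which makes the values of
    \<open>\<phi>\<close> on symbols accessible although \<open>\<phi>\<close> is known only as a
    lift.\<close>
  have \<phi>_pair: "\<exists>A B. A \<in> carrier (uce L) \<and> B \<in> carrier (uce L) \<and> uce_proj L A = x \<and>
      uce_proj L B = y \<and> L.pair x y = \<lbrakk>A, B\<rbrakk>\<^bsub>uce L\<^esub>"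
    if xy: "x \<in> carrier L" "y \<in> carrier L" for x y
  proof -
    obtain A B where "A \<in> carrier (uce L)" "uce_proj L A = x" "B \<in> carrier (uce L)" "uce_proj L B = y"
      using surjL[OF xy(1)] surjL[OF xy(2)] by blast
    then show ?thesis
      by (intro exI[of _ A] exI[of _ B]) (simp add: L.bracket_uce)
  qed
  have "\<psi> (\<phi> X) = X" if X: "X \<in> carrier (uce L)" for X
  proof (rule module_hom_eqI[OF L.spanning_uce comp_mod[OF \<phi>' \<psi> L.uce_module]
        id_mod[OF L.uce_module] _ X])
    fix X assume "X \<in> {L.pair x y | x y. x \<in> carrier L \<and> y \<in> carrier L}"
    then obtain A B where A: "A \<in> carrier (uce L)" and B: "B \<in> carrier (uce L)"
      and X: "X = \<lbrakk>A, B\<rbrakk>\<^bsub>uce L\<^esub>"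
      using \<phi>_pair by blast
    have "\<psi> (\<phi> X) = \<psi> \<lbrakk>\<phi> A, \<phi> B\<rbrakk>\<^bsub>uce E\<^esub>"
      by (simp only: X \<phi>_hom(4)[OF A B])
    also have "\<dots> = X"
      using A B by (simp add: X \<phi>_hom(1) E.bracket_uce E.uce_proj_closed \<psi>_pair \<pi>\<phi> L.bracket_uce)
    finally show "\<psi> (\<phi> X) = X" .
  qed
  moreover have "\<phi> (\<psi> Y) = Y" if Y: "Y \<in> carrier (uce E)" for Y
  proof (rule module_hom_eqI[OF E.spanning_uce comp_mod[OF \<psi> \<phi>' E.uce_module]
        id_mod[OF E.uce_module] _ Y])
    fix Y assume "Y \<in> {E.pair x y | x y. x \<in> carrier E \<and> y \<in> carrier E}"
    then obtain x y where x: "x \<in> carrier E" and y: "y \<in> carrier E" and Y: "Y = E.pair x y"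
      by blast
    obtain A B where A: "A \<in> carrier (uce L)" "uce_proj L A = \<pi> x"
      and B: "B \<in> carrier (uce L)" "uce_proj L B = \<pi> y"
      and AB: "L.pair (\<pi> x) (\<pi> y) = \<lbrakk>A, B\<rbrakk>\<^bsub>uce L\<^esub>"
      using \<phi>_pair[OF hom(1)[OF x] hom(1)[OF y]] by blast
    obtain X' Y' where X': "X' \<in> carrier (uce E)" "uce_proj E X' = x"
      and Y': "Y' \<in> carrier (uce E)" "uce_proj E Y' = y"
      using surjE[OF x] surjE[OF y] by blast
    have "\<phi> (\<psi> Y) = \<lbrakk>\<phi> A, \<phi> B\<rbrakk>\<^bsub>uce E\<^esub>"
      using A B x y by (simp add: Y \<psi>_pair AB \<phi>_hom)
    \<comment> \<open>\<open>\<phi> A\<close> and \<open>X'\<close> lie over the same element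
      \<open>\<pi> x\<close>, likewise \<open>\<phi> B\<close> and \<open>Y'\<close> over
      \<open>\<pi> y\<close>; brackets in a central extension see only these images.\<close>
    also have "\<dots> = \<lbrakk>X', Y'\<rbrakk>\<^bsub>uce E\<^esub>"
      using A B X' Y' by (intro central_bracket_cong[OF extU]) (simp_all add: \<phi>_hom \<pi>\<phi>)
    also have "\<dots> = Y"
      using X' Y' by (simp add: E.bracket_uce Y)
    finally show "\<phi> (\<psi> Y) = Y" .
  qed
  ultimately have "bij_betw \<phi> (carrier (uce L)) (carrier (uce E))"
    using \<phi>_hom(1) LinearCombinations.module_hom_closed[OF \<psi>]
    by (intro bij_betw_byWitness[where f' = \<psi>]) auto
  with \<phi> show ?thesis
    unfolding lie_isomorphic_def by blast
qed

section \<open>Affine Lie algebras\<close>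

lemma affine_simps:
  "(f, a, b) \<in> carrier (affine_lie L \<kappa>) \<longleftrightarrow> f \<in> carrier (mext L)"
  "(f, a, b) \<oplus>\<^bsub>affine_lie L \<kappa>\<^esub> (g, a', b') = (f \<oplus>\<^bsub>mext L\<^esub> g, a + a', b + b')"
  "s \<odot>\<^bsub>affine_lie L \<kappa>\<^esub> (f, a, b) = (s \<odot>\<^bsub>mext L\<^esub> f, s * a, s * b)"
  "\<zero>\<^bsub>affine_lie L \<kappa>\<^esub> = (\<zero>\<^bsub>mext L\<^esub>, 0, 0)"
  "snd (snd \<lbrakk>u, v\<rbrakk>\<^bsub>affine_lie L \<kappa>\<^esub>) = 0"
  by (auto simp: affine_lie_def monoid_extension_def split: prod.split)

lemma submoduleD:
  assumes "submodule (class_ring :: complex ring) N L"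
  shows "N \<subseteq> carrier L" "\<zero>\<^bsub>L\<^esub> \<in> N" "x \<in> N \<Longrightarrow> y \<in> N \<Longrightarrow> x \<oplus>\<^bsub>L\<^esub> y \<in> N" "x \<in> N \<Longrightarrow> a \<odot>\<^bsub>L\<^esub> x \<in> N"
  using submodule.subset[OF assms] submodule.zero_closed[OF assms] submodule.m_closed[OF assms]
    submodule.smult_closed[OF assms] by simp_all

context lie_algebra
begin

lemma lie_algebra_subalgebra:
  assumes N: "submodule (class_ring :: complex ring) N L"
    and bracket: "\<And>x y. x \<in> N \<Longrightarrow> y \<in> N \<Longrightarrow> \<lbrakk>x, y\<rbrakk>\<^bsub>L\<^esub> \<in> N"
  shows "lie_algebra (L\<lparr>carrier := N\<rparr>)"
proof -
  have "Module.module (class_ring :: complex ring) (L\<lparr>carrier := N\<rparr>)"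
    by (rule submodule_is_module[OF N])
  moreover have "x \<in> carrier L" if "x \<in> N" for x
    using submodule.subset[OF N] that by auto
  ultimately show ?thesis
    by (intro lie_algebra.intro lie_algebra_axioms.intro vectorspace.intro class_field)
      (simp_all add: bracket bracket_add_left bracket_add_right bracket_smult_left
        bracket_smult_right bracket_self jacobi)
qed

text \<open>Without d-components the derivation terms disappear, leaving the loop bracket and the
  2-cocycle.\<close>

lemma bracket_affine:
  assumes f: "f \<in> carrier (laurent_lie L)" and g: "g \<in> carrier (laurent_lie L)"
  shows "\<lbrakk>(f, a, 0), (g, a', 0)\<rbrakk>\<^bsub>affine_lie L \<kappa>\<^esub> =
    (\<lbrakk>f, g\<rbrakk>\<^bsub>laurent_lie L\<^esub>, \<Sum>n\<in>{n. f n \<noteq> \<zero>}. of_int n * \<kappa> (f n) (g (- n)), 0)"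
proof -
  have "f n \<in> carrier L" "g n \<in> carrier L" "\<lbrakk>f, g\<rbrakk>\<^bsub>laurent_lie L\<^esub> n \<in> carrier L" for n
    using f g bracket_mext_closed[OF f g] by (auto simp only: mext_simps(1))
  moreover have neg_zero: "\<ominus> \<zero> = \<zero>"
    using M.r_neg[OF M.zero_closed] by simp
  ultimately show ?thesis
    by (simp add: affine_lie_def smult_simps a_minus_def neg_zero)
qed

text \<open>
  The bracket of \<open>x t^0\<close> and \<open>y t^n\<close> has no \<open>c\<close>-component, so perfectness of \<open>L\<close> yields all
  of \<open>L[t\<^sup>\<plusminus>\<^sup>1]\<close>; subtracting \<open>[x, y] t^0\<close> from the bracket of \<open>x t\<close> and \<open>y t^(-1)\<close> leaves \<open>\<kappa>(x, y) c\<close>.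
\<close>

lemma affine_generated:
  assumes perfect: "perfect_lie_algebra L" and nontrivial: "carrier L \<noteq> {\<zero>}"
    and nondegenerate: "nondegenerate_form L \<kappa>"
    and zero: "\<zero>\<^bsub>affine_lie L \<kappa>\<^esub> \<in> K"
    and add: "\<And>u v. u \<in> K \<Longrightarrow> v \<in> K \<Longrightarrow> u \<oplus>\<^bsub>affine_lie L \<kappa>\<^esub> v \<in> K"
    and smult: "\<And>s u. u \<in> K \<Longrightarrow> s \<odot>\<^bsub>affine_lie L \<kappa>\<^esub> u \<in> K"
    and bracket: "\<And>f g. f \<in> carrier (laurent_lie L) \<Longrightarrow> g \<in> carrier (laurent_lie L) \<Longrightarrow>
      \<lbrakk>(f, 0, 0), (g, 0, 0)\<rbrakk>\<^bsub>affine_lie L \<kappa>\<^esub> \<in> K"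
    and f: "f \<in> carrier (laurent_lie L)"
  shows "(f, a, 0) \<in> K"
proof -
  interpret E: lie_algebra "laurent_lie L"
    by (rule lie_algebra_mext)
  have mono: "(monomial L n x, 0, 0) \<in> K" if x: "x \<in> carrier L" for n x
  proof -
    have "x \<in> {x \<in> carrier L. (monomial L n x, 0, 0) \<in> K}" (is "_ \<in> ?N")
    proof (rule perfect_induct[OF perfect _ _ x])
      show "submodule (class_ring :: complex ring) ?N L"
      proof (intro submodule.intro self_module)
        show "\<zero> \<in> ?N"
          using zero by (simp add: affine_simps monomial_zero)
        show "v \<oplus> w \<in> ?N" if "v \<in> ?N" "w \<in> ?N" for v w
          using that add[of "(monomial L n v, 0, 0)" "(monomial L n w, 0, 0)"]
          by (simp add: affine_simps monomial_add)
        show "s \<odot> v \<in> ?N" if "v \<in> ?N" for s v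
          using that smult[of "(monomial L n v, 0, 0)" s] smult_closed[of s v]
          by (simp add: affine_simps monomial_smult)
      qed auto
      fix x y assume x: "x \<in> carrier L" and y: "y \<in> carrier L"
      note c = monomial_closed[OF x, of 0] monomial_closed[OF y, of n]
      \<comment> \<open>Only the index 0 can occur, and the cocycle weights it by 0.\<close>
      have "(\<Sum>k\<in>{k. monomial L 0 x k \<noteq> \<zero>}. of_int k * \<kappa> (monomial L 0 x k) (monomial L n y (- k))) = 0"
        by (intro sum.neutral) (auto simp: monomial_def split: if_splits)
      then show "\<lbrakk>x, y\<rbrakk>\<^bsub>L\<^esub> \<in> ?N"
        using bracket[OF c] x y by (simp add: bracket_affine[OF c] bracket_monomial)
    qed
    then show ?thesis by simp
  qed
  have loop: "(f, 0, 0) \<in> K" if "f \<in> carrier (laurent_lie L)" for f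
    using that
  proof (induction f rule: mext_induct)
    case zero
    then show ?case
      using \<open>\<zero>\<^bsub>affine_lie L \<kappa>\<^esub> \<in> K\<close> by (simp add: affine_simps)
  next
    case (add f g)
    then show ?case
      using assms(5)[of "(f, 0, 0)" "(g, 0, 0)"] by (simp add: affine_simps)
  qed (rule mono)
  obtain x where x: "x \<in> carrier L" "x \<noteq> \<zero>"
    using nontrivial M.zero_closed by blast
  then obtain y where y: "y \<in> carrier L" "\<kappa> x y \<noteq> 0"
    using nondegenerate by (auto simp: nondegenerate_form_def)
  note c = monomial_closed[OF x(1), of 1] monomial_closed[OF y(1), of "- 1"]
  have "{k. monomial L 1 x k \<noteq> \<zero>} = {1 :: int}"
    using x by (auto simp: monomial_def)
  then have "(\<Sum>k\<in>{k. monomial L 1 x k \<noteq> \<zero>}. of_int k * \<kappa> (monomial L 1 x k) (monomial L (- 1) y (- k)))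
      = \<kappa> x y"
    by (simp add: monomial_def)
  then have 1: "(monomial L 0 \<lbrakk>x, y\<rbrakk>\<^bsub>L\<^esub>, \<kappa> x y, 0) \<in> K"
    using bracket[OF c] x y by (simp add: bracket_affine[OF c] bracket_monomial)
  \<comment> \<open>The negative of the loop part, added to isolate a multiple of c.\<close>
  define z where "z = (- 1) \<odot>\<^bsub>laurent_lie L\<^esub> monomial L 0 \<lbrakk>x, y\<rbrakk>\<^bsub>L\<^esub>"
  have m: "monomial L 0 \<lbrakk>x, y\<rbrakk>\<^bsub>L\<^esub> \<in> carrier (laurent_lie L)"
    using x y by (intro monomial_closed) auto
  then have z: "z \<in> carrier (laurent_lie L)"
    unfolding z_def by auto
  have "monomial L 0 \<lbrakk>x, y\<rbrakk>\<^bsub>L\<^esub> \<oplus>\<^bsub>laurent_lie L\<^esub> z = \<zero>\<^bsub>laurent_lie L\<^esub>"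
    using E.smult_simps(3)[OF m, of 1 "- 1"] E.smult_simps(1,2)[OF m] by (simp add: z_def)
  then have "(\<zero>\<^bsub>laurent_lie L\<^esub>, \<kappa> x y, 0) \<in> K"
    using add[OF 1 loop[OF z]] by (simp add: affine_simps)
  \<comment> \<open>Rescaling by \<open>a / \<kappa> x y\<close> turns the coefficient of c into the
    prescribed a.\<close>
  from smult[OF this, of "a / \<kappa> x y"] have "(\<zero>\<^bsub>laurent_lie L\<^esub>, a, 0) \<in> K"
    using y E.rmult_0 by (simp add: affine_simps)
  from add[OF loop[OF f] this] show ?thesis
    using f by (simp add: affine_simps)
qed

end

text \<open>Brackets have no d-component, so the derived algebra lies in the subspace D where that
  component vanishes. Conversely, brackets of elements of D already generate D; this one fact gives
  both the equality with the derived algebra and its perfectness.\<close>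

theorem derived_affine:
  fixes L :: "'a lie_alg" and A :: "'b lie_alg"
  assumes L: "perfect_lie_algebra L" and nontrivial: "carrier L \<noteq> {\<zero>\<^bsub>L\<^esub>}"
    and nondegenerate: "nondegenerate_form L \<kappa>"
    and A: "lie_algebra A" and \<phi>: "\<phi> \<in> lie_hom A (affine_lie L \<kappa>)"
    and bij: "bij_betw \<phi> (carrier A) (carrier (affine_lie L \<kappa>))"
  shows perfect_derived_affine: "perfect_lie_algebra (derived_algebra A)"
    and central_extension_derived_affine:
      "central_extension (derived_algebra A) (\<lambda>x. fst (\<phi> x)) (laurent_lie L)"
proof -
  interpret L: lie_algebra L
    using L by (simp add: perfect_lie_algebra_def)
  interpret A: lie_algebra A by (rule A)
  interpret E: lie_algebra "laurent_lie L"
    by (rule L.lie_algebra_mext)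
  note hom = lie_homD[OF \<phi>]
  define D where "D = {x \<in> carrier A. snd (snd (\<phi> x)) = 0}"
  have in_D: "\<exists>f a. \<phi> x = (f, a, 0) \<and> f \<in> carrier (laurent_lie L)" if x: "x \<in> D" for x
    using that hom(1)[of x] by (cases "\<phi> x") (auto simp: D_def affine_simps)
  have D_surj: "\<exists>x\<in>D. \<phi> x = (f, a, 0)" if "f \<in> carrier (laurent_lie L)" for f a
  proof -
    have "(f, a, 0) \<in> \<phi> ` carrier A"
      using that by (simp add: bij_betw_imp_surj_on[OF bij] affine_simps)
    then show ?thesis
      unfolding D_def by (metis (mono_tags, lifting) imageE mem_Collect_eq snd_conv)
  qed
  \<comment> \<open>Without module laws for the model, \<open>\<phi>\<close> of zero is computed in
    coordinates as 0 times itself.\<close>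
  have \<phi>0: "\<phi> \<zero>\<^bsub>A\<^esub> = \<zero>\<^bsub>affine_lie L \<kappa>\<^esub>"
    using hom(3)[of "\<zero>\<^bsub>A\<^esub>" 0] hom(1)[of "\<zero>\<^bsub>A\<^esub>"] E.smult_simps(2)
    by (cases "\<phi> \<zero>\<^bsub>A\<^esub>") (simp add: affine_simps A.smult_simps)
  have D_sub: "submodule (class_ring :: complex ring) D A"
  proof (intro submodule.intro A.self_module)
    show "\<zero>\<^bsub>A\<^esub> \<in> D"
      by (simp add: D_def \<phi>0 affine_simps)
    show "v \<oplus>\<^bsub>A\<^esub> w \<in> D" if "v \<in> D" "w \<in> D" for v w
      using that in_D[OF that(1)] in_D[OF that(2)] by (auto simp: D_def hom affine_simps)
    show "s \<odot>\<^bsub>A\<^esub> v \<in> D" if "v \<in> D" for s v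
      using that in_D[OF that] by (auto simp: D_def hom affine_simps)
  qed (auto simp: D_def)
  have D_bracket: "\<lbrakk>x, y\<rbrakk>\<^bsub>A\<^esub> \<in> D" if "x \<in> carrier A" "y \<in> carrier A" for x y
    using that by (simp add: D_def hom affine_simps)
  have D_generated: "D \<subseteq> N"
    if N: "submodule (class_ring :: complex ring) N A"
      and brackets: "\<And>x y. x \<in> D \<Longrightarrow> y \<in> D \<Longrightarrow> \<lbrakk>x, y\<rbrakk>\<^bsub>A\<^esub> \<in> N" for N
  proof
    fix x assume x: "x \<in> D"
    note ND = submoduleD[OF N]
    have NA: "y \<in> carrier A" if "y \<in> N" for y
      using ND(1) that by auto
    obtain f a where f: "\<phi> x = (f, a, 0)" "f \<in> carrier (laurent_lie L)"
      using in_D[OF x] by blast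
    \<comment> \<open>The closure conditions of \<open>affine_generated\<close> hold for the image
      of N because \<open>\<phi>\<close> transports the operations; injectivity then brings the
      membership back to N.\<close>
    have "(f, a, 0) \<in> \<phi> ` N"
    proof (rule L.affine_generated[OF L nontrivial nondegenerate _ _ _ _ f(2)])
      show "\<zero>\<^bsub>affine_lie L \<kappa>\<^esub> \<in> \<phi> ` N"
        using imageI[OF ND(2), of \<phi>] by (simp only: \<phi>0)
      show "u \<oplus>\<^bsub>affine_lie L \<kappa>\<^esub> v \<in> \<phi> ` N" if "u \<in> \<phi> ` N" "v \<in> \<phi> ` N" for u v
        using that by (elim imageE) (simp add: NA ND flip: hom(2))
      show "s \<odot>\<^bsub>affine_lie L \<kappa>\<^esub> u \<in> \<phi> ` N" if "u \<in> \<phi> ` N" for s u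
        using that by (elim imageE) (simp add: NA ND flip: hom(3))
      fix g h assume "g \<in> carrier (laurent_lie L)" "h \<in> carrier (laurent_lie L)"
      then obtain u v where uv: "u \<in> D" "v \<in> D" "\<phi> u = (g, 0, 0)" "\<phi> v = (h, 0, 0)"
        using D_surj by metis
      then have "\<phi> \<lbrakk>u, v\<rbrakk>\<^bsub>A\<^esub> = \<lbrakk>(g, 0, 0), (h, 0, 0)\<rbrakk>\<^bsub>affine_lie L \<kappa>\<^esub>"
        by (simp add: hom D_def)
      then show "\<lbrakk>(g, 0, 0), (h, 0, 0)\<rbrakk>\<^bsub>affine_lie L \<kappa>\<^esub> \<in> \<phi> ` N"
        using imageI[OF brackets[OF uv(1,2)], of \<phi>] by simp
    qed
    then obtain y where "y \<in> N" "\<phi> y = \<phi> x"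
      using f(1) by (metis imageE)
    then show "x \<in> N"
      using inj_onD[OF bij_betw_imp_inj_on[OF bij], of y x] x NA by (auto simp: D_def)
  qed
  let ?B = "{\<lbrakk>x, y\<rbrakk>\<^bsub>A\<^esub> | x y. x \<in> carrier A \<and> y \<in> carrier A}"
  have "A.span ?B = D"
  proof (rule subset_antisym)
    show "A.span ?B \<subseteq> D"
      by (rule A.span_is_subset[OF _ D_sub]) (use D_bracket in blast)
    show "D \<subseteq> A.span ?B"
    proof (rule D_generated[OF A.span_is_submodule[OF A.brackets_closed]])
      fix x y assume "x \<in> D" "y \<in> D"
      then show "\<lbrakk>x, y\<rbrakk>\<^bsub>A\<^esub> \<in> A.span ?B"
        using A.in_own_span[OF A.brackets_closed] by (auto simp: D_def)
    qed
  qed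
  then have derived: "derived_algebra A = A\<lparr>carrier := D\<rparr>"
    by (simp add: derived_algebra_def)
  have D_closed: "x \<in> carrier A" if "x \<in> D" for x
    using that by (simp add: D_def)
  interpret D: lie_algebra "A\<lparr>carrier := D\<rparr>"
    by (rule A.lie_algebra_subalgebra[OF D_sub D_bracket]) (simp_all add: D_closed)
  show "perfect_lie_algebra (derived_algebra A)"
    unfolding derived
  proof (rule D.perfectI)
    fix N assume N: "submodule (class_ring :: complex ring) N (A\<lparr>carrier := D\<rparr>)"
      and brackets: "\<And>x y. x \<in> carrier (A\<lparr>carrier := D\<rparr>) \<Longrightarrow> y \<in> carrier (A\<lparr>carrier := D\<rparr>) \<Longrightarrow>
        \<lbrakk>x, y\<rbrakk>\<^bsub>A\<lparr>carrier := D\<rparr>\<^esub> \<in> N"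
    \<comment> \<open>A submodule of D is one of A, so the same generation result applies inside
      D.\<close>
    have "submodule (class_ring :: complex ring) N A"
      using submoduleD[OF N] D_closed by (intro submodule.intro A.self_module) auto
    then show "carrier (A\<lparr>carrier := D\<rparr>) \<subseteq> N"
      using D_generated brackets by simp
  qed
  have bracket: "\<phi> \<lbrakk>x, y\<rbrakk>\<^bsub>A\<^esub> = \<lbrakk>(fst (\<phi> x), fst (snd (\<phi> x)), 0), (fst (\<phi> y), fst (snd (\<phi> y)), 0)\<rbrakk>\<^bsub>affine_lie L \<kappa>\<^esub>"
    "fst (\<phi> x) \<in> carrier (laurent_lie L)" "fst (\<phi> y) \<in> carrier (laurent_lie L)"
    if "x \<in> D" "y \<in> D" for x y
    using in_D[OF that(1)] in_D[OF that(2)] D_closed that by (auto simp: hom)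
  show "central_extension (derived_algebra A) (\<lambda>x. fst (\<phi> x)) (laurent_lie L)"
    unfolding derived central_extension_def
  proof (intro conjI ballI impI D.lie_algebra_axioms E.lie_algebra_axioms)
    have "fst (\<phi> (x \<oplus>\<^bsub>A\<^esub> y)) = fst (\<phi> x) \<oplus>\<^bsub>laurent_lie L\<^esub> fst (\<phi> y)" if "x \<in> D" "y \<in> D" for x y
      using in_D[OF that(1)] in_D[OF that(2)] D_closed that by (auto simp: hom affine_simps)
    moreover have "fst (\<phi> (s \<odot>\<^bsub>A\<^esub> x)) = s \<odot>\<^bsub>laurent_lie L\<^esub> fst (\<phi> x)" if "x \<in> D" for s x
      using in_D[OF that] D_closed that by (auto simp: hom affine_simps)
    ultimately show "(\<lambda>x. fst (\<phi> x)) \<in> lie_hom (A\<lparr>carrier := D\<rparr>) (laurent_lie L)"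
      using bracket by (auto simp: lie_hom_def LinearCombinations.module_hom_def L.bracket_affine)
    show "(\<lambda>x. fst (\<phi> x)) ` carrier (A\<lparr>carrier := D\<rparr>) = carrier (laurent_lie L)"
    proof (intro subset_antisym subsetI)
      fix f assume "f \<in> carrier (laurent_lie L)"
      then obtain x where "x \<in> D" "\<phi> x = (f, 0, 0)"
        using D_surj by blast
      then show "f \<in> (\<lambda>x. fst (\<phi> x)) ` carrier (A\<lparr>carrier := D\<rparr>)"
        by (intro image_eqI[of _ _ x]) simp_all
    qed (use bracket in auto)
    fix z x assume z: "z \<in> carrier (A\<lparr>carrier := D\<rparr>)" "fst (\<phi> z) = \<zero>\<^bsub>laurent_lie L\<^esub>"
      and x: "x \<in> carrier (A\<lparr>carrier := D\<rparr>)"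
    then have zx: "z \<in> D" "x \<in> D"
      by simp_all
    \<comment> \<open>With zero loop part the cocycle is a sum over an empty support, so z, a
      multiple of c, brackets to zero in the model.\<close>
    have "\<phi> \<lbrakk>z, x\<rbrakk>\<^bsub>A\<^esub> = \<phi> \<zero>\<^bsub>A\<^esub>"
      unfolding bracket(1)[OF zx] z(2) L.bracket_affine[OF E.M.zero_closed bracket(3)[OF zx]]
        E.bracket_zero_left[OF bracket(3)[OF zx]] \<phi>0 affine_simps(4)
      by (simp add: mext_simps(2))
    then show "\<lbrakk>z, x\<rbrakk>\<^bsub>A\<lparr>carrier := D\<rparr>\<^esub> = \<zero>\<^bsub>A\<lparr>carrier := D\<rparr>\<^esub>"
      using inj_onD[OF bij_betw_imp_inj_on[OF bij]] D_closed zx by simp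
  qed
qed

theorem proposition4p7:
  fixes g0 :: "'a lie_alg" and g :: "'b lie_alg"
  assumes "simple_lie_algebra g0"
    and "vectorspace.fin_dim class_ring g0"
    and "untwisted_affine g0 g"
    and "\<not> g0 \<cong>\<^sub>L sl2"
  shows "uce (laurent_polynomial_lie g0) \<cong>\<^sub>L uce (polynomial_lie (derived_algebra g))
    \<and> uce (laurent2_lie g0) \<cong>\<^sub>L uce (laurent_lie (derived_algebra g))"
proof -
  interpret L: lie_algebra g0
    using assms(1) by (simp add: simple_lie_algebra_def)
  have perfect: "perfect_lie_algebra g0"
    by (rule simple_imp_perfect[OF assms(1)])
  obtain x y where xy: "x \<in> carrier g0" "y \<in> carrier g0" "\<lbrakk>x, y\<rbrakk>\<^bsub>g0\<^esub> \<noteq> \<zero>\<^bsub>g0\<^esub>"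
    using assms(1) unfolding simple_lie_algebra_def by blast
  then have nontrivial: "carrier g0 \<noteq> {\<zero>\<^bsub>g0\<^esub>}"
    using L.bracket_closed[OF xy(1,2)] by blast
  obtain \<kappa> \<phi> where g: "lie_algebra g" and \<kappa>: "nondegenerate_form g0 \<kappa>"
    and \<phi>: "\<phi> \<in> lie_hom g (affine_lie g0 \<kappa>)"
      "bij_betw \<phi> (carrier g) (carrier (affine_lie g0 \<kappa>))"
    using assms(3) unfolding untwisted_affine_def lie_isomorphic_def by blast
  note derived = derived_affine[OF perfect nontrivial \<kappa> g \<phi>]
  interpret D: lie_algebra "derived_algebra g"
    using derived(1) by (simp add: perfect_lie_algebra_def)
  show ?thesis
    \<comment> \<open>In both cases E is the extension of the derived algebra, and L is
      \<open>g0\<close> extended over \<open>int \<times> nat\<close> or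
      \<open>int \<times> int\<close>; the first factor comes from the loop algebra.\<close>
    by (intro conjI uce_central_extension_iso[OF central_extension_mext[OF derived(2) L.lie_algebra_axioms]]
        D.perfect_mext L.perfect_mext derived(1) perfect)
qed

end
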